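(* For all $d\in\mathbb{N}$, $$\boldsymbol{\lambda}\big(\mathcal{P}_d(\mathbb{S}^1)\big)=\frac{1}{2\pi}\int_0^{2\pi}\bigg|\frac{\sin\big(\frac{d+1}{2}t\big)}{\sin\big(\frac t2\big)}\bigg|\,dt.$$ In particular, $$\lim_{d\to\infty}\frac{\boldsymbol{\lambda}\big(\mathcal{P}_d(\mathbb{S}^1)\big)}{\log d}=\frac{4}{\pi^2}.$$
   Context: $\mathbb{N}=\{1,2,\dots\}$. $\mathbb{S}^1$ is the Euclidean unit circle in $\mathbb{R}^2$. $\mathcal{P}_d(\mathbb{S}^1)$ is the space of restrictions to $\mathbb{S}^1$ of $d$-homogeneous polynomials on $\mathbb{R}^2$ with complex coefficients, a complex Banach space under the supremum norm on $\mathbb{S}^1$. For a subspace $X$ of a Banach space $Y$, $\boldsymbol{\lambda}(X,Y)=\inf\{\|P\|: P\in\mathcal{L}(Y,X),\ P|_X=\mathrm{id}_X\}$ (with $\inf\varnothing=\infty$). The (absolute) projection constant of $X$ is $\boldsymbol{\lambda}(X)=\sup\boldsymbol{\lambda}(I(X),Y)$, the supremum over all complex Banach spaces $Y$ and all linear isometric embeddings $I\colon X\to Y$. *)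

theory Defs
  imports "HOL-Analysis.Analysis" "HOL-Algebra.Module"
begin

text \<open>
  The supremum defining the absolute projection constant runs over all complex Banach spaces, so
  these are represented by records with an explicit carrier set. The vector space structure is that
  of a module over the field \<^term>\<open>complex_field\<close>. (The record of modules inherits
  a multiplication and a unit from the record of rings; these two fields play no role.)
\<close>

definition complex_field :: "complex ring" where
  "complex_field = \<lparr>carrier = UNIV, monoid.mult = (*), one = 1, ring.zero = 0, add = (+)\<rparr>"

record 'a normed_module = "(complex, 'a) module" +
  vnorm :: "'a \<Rightarrow> real" (\<open>\<parallel>_\<parallel>\<index>\<close>)

locale complex_normed_space = module complex_field V
  for V :: "('a, 'm) normed_module_scheme" (structure) +
  assumes vnorm_nonneg: "x \<in> carrier V \<Longrightarrow> 0 \<le> \<parallel>x\<parallel>"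
    and vnorm_eq_zero: "x \<in> carrier V \<Longrightarrow> \<parallel>x\<parallel> = 0 \<Longrightarrow> x = \<zero>"
    and vnorm_smult: "x \<in> carrier V \<Longrightarrow> \<parallel>a \<odot>\<^bsub>V\<^esub> x\<parallel> = cmod a * \<parallel>x\<parallel>"
    and vnorm_triangle:
      "x \<in> carrier V \<Longrightarrow> y \<in> carrier V \<Longrightarrow> \<parallel>x \<oplus> y\<parallel> \<le> \<parallel>x\<parallel> + \<parallel>y\<parallel>"

locale complex_banach_space = complex_normed_space +
  assumes complete:
    "\<lbrakk>range f \<subseteq> carrier V;
      \<And>e. e > 0 \<Longrightarrow> \<exists>N. \<forall>m\<ge>N. \<forall>n\<ge>N. \<parallel>f m \<ominus> f n\<parallel> < e\<rbrakk>
     \<Longrightarrow> \<exists>x \<in> carrier V. (\<lambda>n. \<parallel>f n \<ominus> x\<parallel>) \<longlonglongrightarrow> 0"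

definition linear_maps ::
    "('a, 'm) normed_module_scheme \<Rightarrow> ('b, 'n) normed_module_scheme \<Rightarrow> ('a \<Rightarrow> 'b) set" where
  "linear_maps V W =
     {T. T \<in> carrier V \<rightarrow> carrier W \<and>
         (\<forall>x \<in> carrier V. \<forall>y \<in> carrier V. T (x \<oplus>\<^bsub>V\<^esub> y) = T x \<oplus>\<^bsub>W\<^esub> T y) \<and>
         (\<forall>a. \<forall>x \<in> carrier V. T (a \<odot>\<^bsub>V\<^esub> x) = a \<odot>\<^bsub>W\<^esub> T x)}"

definition bounded_linear_maps ::
    "('a, 'm) normed_module_scheme \<Rightarrow> ('b, 'n) normed_module_scheme \<Rightarrow> ('a \<Rightarrow> 'b) set" where
  "bounded_linear_maps V W =
     {T \<in> linear_maps V W. \<exists>C. \<forall>x \<in> carrier V. \<parallel>T x\<parallel>\<^bsub>W\<^esub> \<le> C * \<parallel>x\<parallel>\<^bsub>V\<^esub>}"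

definition op_norm ::
    "('a, 'm) normed_module_scheme \<Rightarrow> ('b, 'n) normed_module_scheme \<Rightarrow> ('a \<Rightarrow> 'b) \<Rightarrow> ereal" where
  "op_norm V W T = (SUP x \<in> {x \<in> carrier V. \<parallel>x\<parallel>\<^bsub>V\<^esub> \<le> 1}. ereal (\<parallel>T x\<parallel>\<^bsub>W\<^esub>))"

definition isometric_embeddings ::
    "('a, 'm) normed_module_scheme \<Rightarrow> ('b, 'n) normed_module_scheme \<Rightarrow> ('a \<Rightarrow> 'b) set" where
  "isometric_embeddings V W =
     {I \<in> linear_maps V W. \<forall>x \<in> carrier V. \<parallel>I x\<parallel>\<^bsub>W\<^esub> = \<parallel>x\<parallel>\<^bsub>V\<^esub>}"

text \<open>
  The subspace of \<open>Y\<close> with underlying set \<open>X\<close> is the record \<open>Y\<lparr>carrier := X\<rparr>\<close>.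
\<close>

definition rel_proj_const :: "'a set \<Rightarrow> ('a, 'm) normed_module_scheme \<Rightarrow> ereal" where
  "rel_proj_const X Y =
     Inf {op_norm Y (Y\<lparr>carrier := X\<rparr>) P | P.
            P \<in> bounded_linear_maps Y (Y\<lparr>carrier := X\<rparr>) \<and> (\<forall>x \<in> X. P x = x)}"

text \<open>
  HOL cannot quantify over all types, so the absolute projection constant depends on a type
  \<open>'y\<close>, the universe containing the carriers of the spaces \<open>Y\<close>. Every Banach space lives in some
  such universe. A nonzero complex normed space has at least continuum many elements, so a
  statement about the constant should be made for all universes \<open>'y\<close> into which \<^typ>\<open>real\<close>
  can be injected; over smaller ones there is no embedding at all of a nonzero space.
\<close>

definition proj_const :: "'y itself \<Rightarrow> ('x, 'm) normed_module_scheme \<Rightarrow> ereal" where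
  "proj_const u X =
     Sup {rel_proj_const (I ` carrier X) Y | (Y :: 'y normed_module) I.
            complex_banach_space Y \<and> I \<in> isometric_embeddings X Y}"

definition homogeneous_polys :: "nat \<Rightarrow> (real ^ 2 \<Rightarrow> complex) set" where
  "homogeneous_polys d =
     {p. \<exists>c :: nat \<Rightarrow> complex.
           p = (\<lambda>x. \<Sum>k\<le>d. c k * complex_of_real (x $ 1) ^ k * complex_of_real (x $ 2) ^ (d - k))}"

abbreviation circle :: "(real ^ 2) set" where
  "circle \<equiv> sphere 0 1"

definition circle_polys :: "nat \<Rightarrow> (real ^ 2 \<Rightarrow> complex) normed_module" where
  "circle_polys d =
     \<lparr>carrier = (\<lambda>p. restrict p circle) ` homogeneous_polys d,
      monoid.mult = undefined,
      one = undefined,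
      ring.zero = (\<lambda>x \<in> circle. 0),
      add = (\<lambda>f g. \<lambda>x \<in> circle. f x + g x),
      smult = (\<lambda>a f. \<lambda>x \<in> circle. a * f x),
      vnorm = (\<lambda>f. SUP x \<in> circle. cmod (f x))\<rparr>"

end

theory Submission
  imports Defs "HOL-Real_Asymp.Real_Asymp"
begin

text \<open>
  Multiplication by \<open>cis (d \<theta>)\<close> and the substitution \<open>t = 2 \<theta>\<close> turn the restriction of a
  \<open>d\<close>-homogeneous polynomial to the circle isometrically into a trigonometric sum
  \<open>\<Sum>k\<le>d. a k * cis (k t)\<close>, and the modulus of the Dirichlet kernel \<open>\<Sum>k\<le>d. cis (k t)\<close> is the
  integrand of the theorem. Integrals over the circle are replaced throughout by means over \<open>N\<close>
  equidistant nodes, which are exact on trigonometric polynomials of degree less than \<open>N\<close>.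

  Upper bound: the evaluations at the nodes extend by Hahn-Banach to functionals of norm at most 1
  on any superspace, and discrete convolution with the Dirichlet kernel turns them into a projection
  whose norm is at most a Riemann sum of the integral.

  Lower bound: in the space of bounded continuous functions on the real line, averaging a projection
  over the rotations by the nodes turns it into discrete convolution with the Dirichlet kernel on
  every fixed trigonometric polynomial (Rudin's argument). It is tested on trigonometric
  polynomials that approximate the phase of the kernel.

  Asymptotics: each interval between consecutive zeros of the numerator contributes a term of a
  harmonic sum to the integral.
\<close>

section \<open>The Hahn-Banach theorem\<close>

text \<open>Finite node sets replace integrals because the objects to be averaged have no
  regularity. In the upper bound the Hahn-Banach extensions are chosen separately at each point, so
  their dependence on the point need not even be measurable. In the lower bound translation is not
  norm continuous on all bounded continuous functions, so an integral of translated operators would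
  need justification, while a finite average is pure algebra. The price is aliasing: N nodes see
  frequencies only modulo N. The averaged projection is therefore under control only on polynomials
  whose degree is small against N, and the test function has to be fixed before N is chosen. The
  superspace in the lower bound must fit into every universe that admits an injection of the reals.
  The bounded functions on an interval are too many for that; a continuous function is determined by
  countably many values, so there are only continuum many. The functions live on the line and need
  not be periodic, since the averaged projection is only ever tested on trigonometric
  polynomials.\<close>

lemma complex_field_simps [simp]:
  "carrier complex_field = UNIV" "x \<otimes>\<^bsub>complex_field\<^esub> y = x * y" "\<one>\<^bsub>complex_field\<^esub> = 1"
  "\<zero>\<^bsub>complex_field\<^esub> = 0" "x \<oplus>\<^bsub>complex_field\<^esub> y = x + y"
  by (simp_all add: complex_field_def)

lemma cring_complex_field: "cring complex_field"
proof (intro cringI abelian_groupI comm_monoidI)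
  show "\<exists>y\<in>carrier complex_field. y \<oplus>\<^bsub>complex_field\<^esub> x = \<zero>\<^bsub>complex_field\<^esub>" for x
    by (rule bexI[of _ "- x"]) auto
qed (auto simp: algebra_simps)

context complex_normed_space
begin

definition real_smult :: "real \<Rightarrow> 'a \<Rightarrow> 'a" where "real_smult t x = complex_of_real t \<odot>\<^bsub>V\<^esub> x"

lemma smult_closed_UNIV [simp]: "x \<in> carrier V \<Longrightarrow> a \<odot>\<^bsub>V\<^esub> x \<in> carrier V"
  by (rule smult_closed) auto

lemma smult_smult: "x \<in> carrier V \<Longrightarrow> a \<odot>\<^bsub>V\<^esub> (b \<odot>\<^bsub>V\<^esub> x) = (a * b) \<odot>\<^bsub>V\<^esub> x"
  using smult_assoc1[of a b x] by simp

lemma smult_add: "x \<in> carrier V \<Longrightarrow> (a + b) \<odot>\<^bsub>V\<^esub> x = a \<odot>\<^bsub>V\<^esub> x \<oplus>\<^bsub>V\<^esub> b \<odot>\<^bsub>V\<^esub> x"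
  using smult_l_distr[of a b x] by simp

lemma smult_1 [simp]: "x \<in> carrier V \<Longrightarrow> 1 \<odot>\<^bsub>V\<^esub> x = x"
  using smult_one[of x] by simp

lemma smult_0 [simp]: "x \<in> carrier V \<Longrightarrow> 0 \<odot>\<^bsub>V\<^esub> x = \<zero>\<^bsub>V\<^esub>"
  using smult_l_null[of x] by simp

lemma smult_minus_1: "x \<in> carrier V \<Longrightarrow> \<ominus>\<^bsub>V\<^esub> x = (-1) \<odot>\<^bsub>V\<^esub> x"
  using smult_add[of x 1 "-1"] by (intro minus_equality) (simp_all add: a_comm)

lemma real_smult_closed [simp]: "x \<in> carrier V \<Longrightarrow> real_smult t x \<in> carrier V"
  by (simp add: real_smult_def)

lemma real_smult_add: "x \<in> carrier V \<Longrightarrow> y \<in> carrier V \<Longrightarrow> real_smult t (x \<oplus>\<^bsub>V\<^esub> y) = real_smult t x \<oplus>\<^bsub>V\<^esub> real_smult t y"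
  by (simp add: real_smult_def smult_r_distr)

lemma real_smult_add_left: "x \<in> carrier V \<Longrightarrow> real_smult (s + t) x = real_smult s x \<oplus>\<^bsub>V\<^esub> real_smult t x"
  by (simp add: real_smult_def smult_add)

lemma real_smult_real_smult: "x \<in> carrier V \<Longrightarrow> real_smult s (real_smult t x) = real_smult (s * t) x"
  by (simp add: real_smult_def smult_smult)

lemma real_smult_1 [simp]: "x \<in> carrier V \<Longrightarrow> real_smult 1 x = x"
  and real_smult_0 [simp]: "x \<in> carrier V \<Longrightarrow> real_smult 0 x = \<zero>\<^bsub>V\<^esub>"
  by (simp_all add: real_smult_def)

lemma real_smult_minus: "x \<in> carrier V \<Longrightarrow> \<ominus>\<^bsub>V\<^esub> x = real_smult (-1) x"
  by (simp add: real_smult_def smult_minus_1)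

lemma norm_real_smult: "x \<in> carrier V \<Longrightarrow> \<parallel>real_smult t x\<parallel>\<^bsub>V\<^esub> = \<bar>t\<bar> * \<parallel>x\<parallel>\<^bsub>V\<^esub>"
  by (simp add: real_smult_def vnorm_smult)

lemma norm_zero [simp]: "\<parallel>\<zero>\<^bsub>V\<^esub>\<parallel>\<^bsub>V\<^esub> = 0"
  using norm_real_smult[of "\<zero>\<^bsub>V\<^esub>" 0] by simp

lemma norm_uminus [simp]: "x \<in> carrier V \<Longrightarrow> \<parallel>\<ominus>\<^bsub>V\<^esub> x\<parallel>\<^bsub>V\<^esub> = \<parallel>x\<parallel>\<^bsub>V\<^esub>"
  by (simp add: real_smult_minus norm_real_smult)

section \<open>Sublinear functionals and their minimal elements\<close>

text \<open>
  The value 0 outside the carrier makes the pointwise order antisymmetric, as Zorn's lemma needs.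
\<close>
definition sublinear :: "('a \<Rightarrow> real) \<Rightarrow> bool" where
  "sublinear p \<longleftrightarrow>
     (\<forall>x\<in>carrier V. \<forall>y\<in>carrier V. p (x \<oplus>\<^bsub>V\<^esub> y) \<le> p x + p y) \<and>
     (\<forall>x\<in>carrier V. \<forall>t\<ge>0. p (real_smult t x) \<le> t * p x) \<and>
     (\<forall>x\<in>carrier V. p x \<le> \<parallel>x\<parallel>\<^bsub>V\<^esub>) \<and> (\<forall>x. x \<notin> carrier V \<longrightarrow> p x = 0)"

lemma sublinearD:
  assumes "sublinear p"
  shows "x \<in> carrier V \<Longrightarrow> y \<in> carrier V \<Longrightarrow> p (x \<oplus>\<^bsub>V\<^esub> y) \<le> p x + p y"
    and "x \<in> carrier V \<Longrightarrow> t \<ge> 0 \<Longrightarrow> p (real_smult t x) \<le> t * p x"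
    and "x \<in> carrier V \<Longrightarrow> p x \<le> \<parallel>x\<parallel>\<^bsub>V\<^esub>"
    and "x \<notin> carrier V \<Longrightarrow> p x = 0"
  using assms by (auto simp: sublinear_def)

text \<open>The missing inequality is the assumed one for the factor \<open>1 / t\<close> at the
  point \<open>real_smult t x\<close>. At \<open>t = 0\<close> it comes from subadditivity at zero,
  which forces a nonnegative value there.\<close>

lemma sublinear_scale:
  assumes "sublinear p" "x \<in> carrier V" "t \<ge> 0"
  shows "p (real_smult t x) = t * p x"
proof (cases "t = 0")
  case True
  have "p (real_smult 0 x) \<le> 0" using sublinearD(2)[OF assms(1,2), of 0] by simp
  moreover have "p \<zero>\<^bsub>V\<^esub> \<le> p \<zero>\<^bsub>V\<^esub> + p \<zero>\<^bsub>V\<^esub>"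
    using sublinearD(1)[OF assms(1), of "\<zero>\<^bsub>V\<^esub>" "\<zero>\<^bsub>V\<^esub>"] by simp
  ultimately show ?thesis using True assms(2) by simp
next
  case False
  then have t: "t > 0" using assms by simp
  have "p (real_smult (1 / t) (real_smult t x)) \<le> 1 / t * p (real_smult t x)"
    using assms t by (intro sublinearD(2)) auto
  then have "p x \<le> 1 / t * p (real_smult t x)" using t assms(2) by (simp add: real_smult_real_smult)
  then have "t * p x \<le> p (real_smult t x)" using t by (simp add: field_simps)
  with sublinearD(2)[OF assms] show ?thesis by simp
qed

text \<open>Subadditivity applied to \<open>x\<close> and its negative. The lower bound by the norm
  is what makes pointwise infima of sublinear functionals well behaved.\<close>

lemma sublinear_ge:
  assumes "sublinear p" "x \<in> carrier V"
  shows "- p (\<ominus>\<^bsub>V\<^esub> x) \<le> p x" and "- \<parallel>x\<parallel>\<^bsub>V\<^esub> \<le> p x"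
proof -
  have "p (x \<oplus>\<^bsub>V\<^esub> \<ominus>\<^bsub>V\<^esub> x) \<le> p x + p (\<ominus>\<^bsub>V\<^esub> x)"
    by (rule sublinearD(1)[OF assms(1)]) (use assms in auto)
  moreover have "p \<zero>\<^bsub>V\<^esub> = 0" using sublinear_scale[OF assms, of 0] assms by simp
  ultimately show *: "- p (\<ominus>\<^bsub>V\<^esub> x) \<le> p x" using assms by (simp add: r_neg)
  have "p (\<ominus>\<^bsub>V\<^esub> x) \<le> \<parallel>x\<parallel>\<^bsub>V\<^esub>" using sublinearD(3)[OF assms(1), of "\<ominus>\<^bsub>V\<^esub> x"] assms by simp
  with * show "- \<parallel>x\<parallel>\<^bsub>V\<^esub> \<le> p x" by simp
qed

text \<open>Subadditivity of the infimum has to compare \<open>p x + q y\<close> for different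
  members \<open>p\<close> and \<open>q\<close>; the smaller of the two lies below both, and this is
  where the chain condition enters.\<close>

lemma sublinear_chain_INF:
  assumes C: "C \<noteq> {}" "\<And>p. p \<in> C \<Longrightarrow> sublinear p" "\<And>p q. p \<in> C \<Longrightarrow> q \<in> C \<Longrightarrow> p \<le> q \<or> q \<le> p"
  shows "sublinear (\<lambda>x. INF p\<in>C. p x)" and "p \<in> C \<Longrightarrow> (\<lambda>x. INF p\<in>C. p x) \<le> p"
proof -
  have bdd: "bdd_below ((\<lambda>p. p x) ` C)" for x
  proof (cases "x \<in> carrier V")
    case True
    show ?thesis by (rule bdd_belowI2[of _ "- \<parallel>x\<parallel>\<^bsub>V\<^esub>"]) (use sublinear_ge True C in auto)
  next
    case False
    show ?thesis by (rule bdd_belowI2[of _ 0]) (use sublinearD(4) False C in force)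
  qed
  have low: "(INF p\<in>C. p x) \<le> p x" if "p \<in> C" for p x
    by (rule cINF_lower[OF bdd that])
  then show "(\<lambda>x. INF p\<in>C. p x) \<le> p" if "p \<in> C" for p
    using that by (simp add: le_fun_def)
  show "sublinear (\<lambda>x. INF p\<in>C. p x)"
    unfolding sublinear_def
  proof (intro conjI ballI allI impI)
    fix x y assume xy: "x \<in> carrier V" "y \<in> carrier V"
    have *: "(INF p\<in>C. p (x \<oplus>\<^bsub>V\<^esub> y)) \<le> p x + q y" if "p \<in> C" "q \<in> C" for p q
    proof -
      note pq = that
      have "\<exists>r\<in>C. r \<le> p \<and> r \<le> q"
      proof (cases "p \<le> q")
        case True
        show ?thesis by (rule bexI[of _ p]) (use True pq in simp_all)
      next
        case False
        then have "q \<le> p" using C(3)[OF pq] by simp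
        show ?thesis by (rule bexI[of _ q]) (use \<open>q \<le> p\<close> pq in simp_all)
      qed
      then obtain r where r: "r \<in> C" "r \<le> p" "r \<le> q" by blast
      have "(INF p\<in>C. p (x \<oplus>\<^bsub>V\<^esub> y)) \<le> r (x \<oplus>\<^bsub>V\<^esub> y)" using low[OF r(1)] .
      also have "\<dots> \<le> r x + r y" by (rule sublinearD(1)[OF C(2)[OF r(1)] xy])
      also have "\<dots> \<le> p x + q y" by (rule add_mono[OF le_funD[OF r(2)] le_funD[OF r(3)]])
      finally show ?thesis .
    qed
    have "(INF p\<in>C. p (x \<oplus>\<^bsub>V\<^esub> y)) - p x \<le> (INF q\<in>C. q y)" if "p \<in> C" for p
      by (rule cINF_greatest[OF C(1)]) (use *[OF that] in force)
    then have "(INF p\<in>C. p (x \<oplus>\<^bsub>V\<^esub> y)) - (INF q\<in>C. q y) \<le> (INF p\<in>C. p x)"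
      by (intro cINF_greatest[OF C(1)]) force
    then show "(INF p\<in>C. p (x \<oplus>\<^bsub>V\<^esub> y)) \<le> (INF p\<in>C. p x) + (INF q\<in>C. q y)" by simp
  next
    fix x and t :: real assume x: "x \<in> carrier V" "t \<ge> 0"
    show "(INF p\<in>C. p (real_smult t x)) \<le> t * (INF p\<in>C. p x)"
    proof (cases "t = 0")
      case True
      obtain p where "p \<in> C" using C by auto
      then show ?thesis using low[of p "real_smult t x"] sublinear_scale[OF C(2)[of p] x] True by simp
    next
      case False
      have "(INF p\<in>C. p (real_smult t x)) / t \<le> p x" if "p \<in> C" for p
        using low[OF that, of "real_smult t x"] sublinear_scale[OF C(2)[OF that] x] False x
        by (simp add: divide_le_eq mult.commute)
      then have "(INF p\<in>C. p (real_smult t x)) / t \<le> (INF p\<in>C. p x)"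
        by (intro cINF_greatest[OF C(1)])
      then show ?thesis using False x by (simp add: divide_le_eq mult.commute)
    qed
  next
    fix x assume x: "x \<in> carrier V"
    obtain p where p: "p \<in> C" using C(1) by auto
    show "(INF p\<in>C. p x) \<le> \<parallel>x\<parallel>\<^bsub>V\<^esub>"
      using low[OF p, of x] sublinearD(3)[OF C(2)[OF p] x] by simp
  next
    fix x assume "x \<notin> carrier V"
    then have "(INF p\<in>C. p x) = (INF p\<in>C. 0)"
      using C sublinearD(4) by (intro INF_cong) auto
    then show "(INF p\<in>C. p x) = 0" using C by simp
  qed
qed

text \<open>Zorn's lemma for the reversed order: an upper bound of a chain is its pointwise infimum,
  and the empty chain is bounded by \<open>q\<close> itself.\<close>

lemma ex_minimal_sublinear:
  assumes "sublinear q"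
  obtains p where "sublinear p" "p \<le> q" "\<And>r. sublinear r \<Longrightarrow> r \<le> p \<Longrightarrow> r = p"
proof -
  let ?S = "{p. sublinear p \<and> p \<le> q}"
  have "\<exists>m\<in>?S. \<forall>a\<in>?S. m \<ge> a \<longrightarrow> a = m"
  proof (rule predicate_Zorn)
    show "partial_order_on ?S (relation_of (\<ge>) ?S)"
      by (rule partial_order_on_relation_ofI) auto
  next
    fix C assume C: "C \<in> Chains (relation_of (\<ge>) ?S)"
    have CS: "C \<subseteq> ?S" and ch: "\<And>p r. p \<in> C \<Longrightarrow> r \<in> C \<Longrightarrow> p \<le> r \<or> r \<le> p"
      using C by (auto simp: Chains_def relation_of_def)
    show "\<exists>u\<in>?S. \<forall>a\<in>C. a \<ge> u"
    proof (cases "C = {}")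
      case True
      then show ?thesis using assms by auto
    next
      case False
      define u where "u = (\<lambda>x. INF p\<in>C. p x)"
      have sl: "sublinear p" if "p \<in> C" for p using CS that by auto
      have "sublinear u" unfolding u_def by (rule sublinear_chain_INF(1)[OF False sl ch])
      moreover have le: "u \<le> p" if "p \<in> C" for p
        unfolding u_def by (rule sublinear_chain_INF(2)[OF False sl ch that])
      moreover obtain p where "p \<in> C" using False by auto
      then have "u \<le> p" "p \<le> q" using le[of p] CS by auto
      then have "u \<le> q" by (rule order_trans)
      ultimately show ?thesis by blast
    qed
  qed
  then obtain m where "m \<in> ?S" "\<And>a. a \<in> ?S \<Longrightarrow> a \<le> m \<Longrightarrow> a = m" by auto
  then show ?thesis using that[of m] by (auto intro: order_trans)
qed

text \<open>
  A sublinear \<open>p\<close> dominates the sublinear map sending \<open>x\<close> to the infimum of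
  \<open>p (x + t y) - t p y\<close> over \<open>t \<ge> 0\<close>, so minimality forces equality at \<open>t = 1\<close>.
\<close>
lemma minimal_sublinear_add:
  assumes p: "sublinear p" and min: "\<And>r. sublinear r \<Longrightarrow> r \<le> p \<Longrightarrow> r = p"
    and xy: "x \<in> carrier V" "y \<in> carrier V"
  shows "p (x \<oplus>\<^bsub>V\<^esub> y) = p x + p y"
proof -
  define g where "g x t = p (x \<oplus>\<^bsub>V\<^esub> real_smult t y) - t * p y" for x t
  define r where "r x = (if x \<in> carrier V then INF t\<in>{0..}. g x t else 0)" for x
  have bdd: "bdd_below (g x ` {0..})" if x: "x \<in> carrier V" for x
  proof (rule bdd_belowI2)
    fix t :: real assume "t \<in> {0..}"
    then have t: "t \<ge> 0" by simp
    \<comment> \<open>Since \<open>t * p y\<close> is the value of \<open>p\<close> at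
      \<open>t y\<close>, a lower bound for \<open>g x t\<close> that does not depend on
      \<open>t\<close> follows from writing \<open>t y\<close> as
      \<open>(x + t y) - x\<close>.\<close>
    have "real_smult t y = (x \<oplus>\<^bsub>V\<^esub> real_smult t y) \<oplus>\<^bsub>V\<^esub> \<ominus>\<^bsub>V\<^esub> x"
      using x xy by (metis a_comm a_inv_closed add.m_closed r_neg1 real_smult_closed)
    then have "p (real_smult t y) \<le> p (x \<oplus>\<^bsub>V\<^esub> real_smult t y) + p (\<ominus>\<^bsub>V\<^esub> x)"
      using sublinearD(1)[OF p, of "x \<oplus>\<^bsub>V\<^esub> real_smult t y" "\<ominus>\<^bsub>V\<^esub> x"] x xy by simp
    then show "- p (\<ominus>\<^bsub>V\<^esub> x) \<le> g x t"
      using sublinear_scale[OF p xy(2) t] by (simp add: g_def)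
  qed
  have low: "r x \<le> g x t" if "x \<in> carrier V" "t \<ge> 0" for x t
    using cINF_lower[OF bdd[OF that(1)], of t] that by (simp add: r_def)
  have great: "c \<le> r x" if "x \<in> carrier V" "\<And>t. t \<ge> 0 \<Longrightarrow> c \<le> g x t" for c x
    using cINF_greatest[of "{0..}" c "g x"] that by (auto simp: r_def)
  have le: "r \<le> p"
  proof (rule le_funI)
    fix x
    show "r x \<le> p x"
    proof (cases "x \<in> carrier V")
      case True
      then show ?thesis using low[OF True, of 0] xy by (simp add: g_def)
    next
      case False
      then show ?thesis using sublinearD(4)[OF p] by (simp add: r_def)
    qed
  qed
  have "sublinear r"
    unfolding sublinear_def
  proof (intro conjI ballI allI impI)
    fix u v assume uv: "u \<in> carrier V" "v \<in> carrier V"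
    have *: "r (u \<oplus>\<^bsub>V\<^esub> v) \<le> g u s + g v t" if "s \<ge> 0" "t \<ge> 0" for s t
    proof -
      have eq: "(u \<oplus>\<^bsub>V\<^esub> v) \<oplus>\<^bsub>V\<^esub> real_smult (s + t) y = (u \<oplus>\<^bsub>V\<^esub> real_smult s y) \<oplus>\<^bsub>V\<^esub> (v \<oplus>\<^bsub>V\<^esub> real_smult t y)"
        using uv xy by (simp add: real_smult_add_left a_ac)
      have "r (u \<oplus>\<^bsub>V\<^esub> v) \<le> g (u \<oplus>\<^bsub>V\<^esub> v) (s + t)" using low uv that by simp
      also have "\<dots> \<le> g u s + g v t"
        unfolding g_def eq using sublinearD(1)[OF p, of "u \<oplus>\<^bsub>V\<^esub> real_smult s y" "v \<oplus>\<^bsub>V\<^esub> real_smult t y"] uv xy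
        by (simp add: algebra_simps)
      finally show ?thesis .
    qed
    have "r (u \<oplus>\<^bsub>V\<^esub> v) - g u s \<le> r v" if "s \<ge> 0" for s
      by (rule great) (use * that uv in force)+
    then have "r (u \<oplus>\<^bsub>V\<^esub> v) - r v \<le> r u" by (intro great) (use uv in force)+
    then show "r (u \<oplus>\<^bsub>V\<^esub> v) \<le> r u + r v" by simp
  next
    fix u and s :: real assume u: "u \<in> carrier V" "s \<ge> 0"
    have *: "r (real_smult s u) \<le> s * g u t" if t: "t \<ge> 0" for t
    proof -
      have eq: "real_smult s u \<oplus>\<^bsub>V\<^esub> real_smult (s * t) y = real_smult s (u \<oplus>\<^bsub>V\<^esub> real_smult t y)"
        using u xy by (simp add: real_smult_add real_smult_real_smult)
      have "r (real_smult s u) \<le> g (real_smult s u) (s * t)" using low u t by simp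
      also have "\<dots> \<le> s * g u t"
        unfolding g_def eq using sublinearD(2)[OF p, of "u \<oplus>\<^bsub>V\<^esub> real_smult t y" s] u xy
        by (simp add: algebra_simps)
      finally show ?thesis .
    qed
    show "r (real_smult s u) \<le> s * r u"
    proof (cases "s = 0")
      case True
      then show ?thesis using *[of 0] by simp
    next
      case False
      have "r (real_smult s u) / s \<le> r u"
        by (rule great) (use u * False in \<open>auto simp: divide_le_eq mult.commute\<close>)
      then show ?thesis using False u by (simp add: divide_le_eq mult.commute)
    qed
  next
    fix u assume "u \<in> carrier V"
    then show "r u \<le> \<parallel>u\<parallel>\<^bsub>V\<^esub>"
      using le_funD[OF le, of u] sublinearD(3)[OF p, of u] by simp
  qed (simp add: r_def)
  then have "r = p" by (rule min[OF _ le])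
  then have "p x \<le> g x 1" using low[OF xy(1), of 1] by simp
  then show ?thesis using sublinearD(1)[OF p xy] xy by (simp add: g_def)
qed

text \<open>No extension by one dimension at a time: the function \<open>q\<close>, the infimum of
  \<open>\<parallel>y - x\<parallel> + f x\<close> over \<open>x\<close> in \<open>M\<close>, is
  sublinear and encodes both the norm and \<open>f\<close>. A minimal sublinear functional below it
  is additive, hence linear, and it is the extension.\<close>

lemma hahn_banach_real:
  assumes M: "M \<subseteq> carrier V" "M \<noteq> {}"
    "\<And>x y. x \<in> M \<Longrightarrow> y \<in> M \<Longrightarrow> x \<oplus>\<^bsub>V\<^esub> y \<in> M" "\<And>t x. x \<in> M \<Longrightarrow> real_smult t x \<in> M"
    and f: "\<And>x y. x \<in> M \<Longrightarrow> y \<in> M \<Longrightarrow> f (x \<oplus>\<^bsub>V\<^esub> y) = f x + f y"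
    "\<And>t x. x \<in> M \<Longrightarrow> f (real_smult t x) = t * f x"
    "\<And>x. x \<in> M \<Longrightarrow> \<bar>f x\<bar> \<le> \<parallel>x\<parallel>\<^bsub>V\<^esub>"
  obtains u :: "'a \<Rightarrow> real" where
    "\<And>x y. x \<in> carrier V \<Longrightarrow> y \<in> carrier V \<Longrightarrow> u (x \<oplus>\<^bsub>V\<^esub> y) = u x + u y"
    "\<And>t x. x \<in> carrier V \<Longrightarrow> u (real_smult t x) = t * u x"
    "\<And>x. x \<in> carrier V \<Longrightarrow> u x \<le> \<parallel>x\<parallel>\<^bsub>V\<^esub>"
    "\<And>x. x \<in> M \<Longrightarrow> u x = f x"
proof -
  define g where "g y x = \<parallel>y \<ominus>\<^bsub>V\<^esub> x\<parallel>\<^bsub>V\<^esub> + f x" for x y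
  define q where "q y = (if y \<in> carrier V then INF x\<in>M. g y x else 0)" for y
  have MC: "x \<in> M \<Longrightarrow> x \<in> carrier V" for x using M by auto
  have zM: "\<zero>\<^bsub>V\<^esub> \<in> M" using M(2) M(4)[of _ 0] MC by auto
  have f0: "f \<zero>\<^bsub>V\<^esub> = 0" using f(2)[OF zM, of 0] by simp
  have bdd: "bdd_below (g y ` M)" if y: "y \<in> carrier V" for y
  proof (rule bdd_belowI2)
    fix x assume x: "x \<in> M"
    have "\<parallel>x\<parallel>\<^bsub>V\<^esub> = \<parallel>y \<oplus>\<^bsub>V\<^esub> \<ominus>\<^bsub>V\<^esub> (y \<ominus>\<^bsub>V\<^esub> x)\<parallel>\<^bsub>V\<^esub>"
      using x y MC by (simp add: a_minus_def minus_add r_neg2)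
    also have "\<dots> \<le> \<parallel>y\<parallel>\<^bsub>V\<^esub> + \<parallel>\<ominus>\<^bsub>V\<^esub> (y \<ominus>\<^bsub>V\<^esub> x)\<parallel>\<^bsub>V\<^esub>"
      using x y MC by (intro vnorm_triangle) auto
    finally have "\<parallel>x\<parallel>\<^bsub>V\<^esub> \<le> \<parallel>y\<parallel>\<^bsub>V\<^esub> + \<parallel>y \<ominus>\<^bsub>V\<^esub> x\<parallel>\<^bsub>V\<^esub>" using x y MC by simp
    then show "- \<parallel>y\<parallel>\<^bsub>V\<^esub> \<le> g y x" using f(3)[OF x] by (simp add: g_def)
  qed
  have low: "q y \<le> g y x" if "y \<in> carrier V" "x \<in> M" for x y
    using cINF_lower[OF bdd[OF that(1)] that(2)] that by (simp add: q_def)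
  have great: "c \<le> q y" if "y \<in> carrier V" "\<And>x. x \<in> M \<Longrightarrow> c \<le> g y x" for c y
    using cINF_greatest[of M c "g y"] that M(2) by (auto simp: q_def)
  have "sublinear q"
    unfolding sublinear_def
  proof (intro conjI ballI allI impI)
    fix u v assume uv: "u \<in> carrier V" "v \<in> carrier V"
    have *: "q (u \<oplus>\<^bsub>V\<^esub> v) \<le> g u x + g v y" if "x \<in> M" "y \<in> M" for x y
    proof -
      have eq: "(u \<oplus>\<^bsub>V\<^esub> v) \<ominus>\<^bsub>V\<^esub> (x \<oplus>\<^bsub>V\<^esub> y) = (u \<ominus>\<^bsub>V\<^esub> x) \<oplus>\<^bsub>V\<^esub> (v \<ominus>\<^bsub>V\<^esub> y)"
        using uv that MC by (simp add: a_minus_def minus_add a_ac)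
      have "q (u \<oplus>\<^bsub>V\<^esub> v) \<le> g (u \<oplus>\<^bsub>V\<^esub> v) (x \<oplus>\<^bsub>V\<^esub> y)" using low uv that M by simp
      also have "\<dots> \<le> g u x + g v y"
        unfolding g_def eq using vnorm_triangle[of "u \<ominus>\<^bsub>V\<^esub> x" "v \<ominus>\<^bsub>V\<^esub> y"] uv that MC f(1)
        by simp
      finally show ?thesis .
    qed
    have "q (u \<oplus>\<^bsub>V\<^esub> v) - g u x \<le> q v" if "x \<in> M" for x
      by (rule great) (use * that uv in force)+
    then have "q (u \<oplus>\<^bsub>V\<^esub> v) - q v \<le> q u" by (intro great) (use uv in force)+
    then show "q (u \<oplus>\<^bsub>V\<^esub> v) \<le> q u + q v" by simp
  next
    fix u and s :: real assume u: "u \<in> carrier V" "s \<ge> 0"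
    have *: "q (real_smult s u) \<le> s * g u x" if x: "x \<in> M" for x
    proof -
      have eq: "real_smult s u \<ominus>\<^bsub>V\<^esub> real_smult s x = real_smult s (u \<ominus>\<^bsub>V\<^esub> x)"
        using u x MC by (simp add: a_minus_def real_smult_minus real_smult_add real_smult_real_smult)
      have "q (real_smult s u) \<le> g (real_smult s u) (real_smult s x)" using low u x M by simp
      also have "\<dots> = s * g u x"
        unfolding g_def eq using u x MC f(2) by (simp add: norm_real_smult algebra_simps)
      finally show ?thesis .
    qed
    show "q (real_smult s u) \<le> s * q u"
    proof (cases "s = 0")
      case True
      then show ?thesis using *[OF zM] by simp
    next
      case False
      have "q (real_smult s u) / s \<le> q u"
        by (rule great) (use u * False in \<open>auto simp: divide_le_eq mult.commute\<close>)
      then show ?thesis using False u by (simp add: divide_le_eq mult.commute)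
    qed
  next
    fix u assume u: "u \<in> carrier V"
    have "\<ominus>\<^bsub>V\<^esub> \<zero>\<^bsub>V\<^esub> = \<zero>\<^bsub>V\<^esub>" by (rule minus_equality) simp_all
    then have "u \<ominus>\<^bsub>V\<^esub> \<zero>\<^bsub>V\<^esub> = u" unfolding a_minus_def by (metis r_zero u)
    then show "q u \<le> \<parallel>u\<parallel>\<^bsub>V\<^esub>" using low[OF u zM] f0 by (simp add: g_def)
  qed (simp add: q_def)
  then obtain p where p: "sublinear p" "p \<le> q" "\<And>r. sublinear r \<Longrightarrow> r \<le> p \<Longrightarrow> r = p"
    using ex_minimal_sublinear by blast
  note add = minimal_sublinear_add[OF p(1,3)]
  have p0: "p \<zero>\<^bsub>V\<^esub> = 0" using sublinear_scale[OF p(1), of "\<zero>\<^bsub>V\<^esub>" 0] by simp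
  have neg: "p (real_smult (-1) x) = - p x" if "x \<in> carrier V" for x
    using add[of x "\<ominus>\<^bsub>V\<^esub> x"] that p0 by (simp add: real_smult_minus[symmetric] r_neg)
  have scale: "p (real_smult t x) = t * p x" if x: "x \<in> carrier V" for t x
  proof (cases "t \<ge> 0")
    case True
    then show ?thesis using sublinear_scale[OF p(1) x] by simp
  next
    case False
    have "p (real_smult t x) = p (real_smult (-1) (real_smult (-t) x))" using x by (simp add: real_smult_real_smult)
    also have "\<dots> = t * p x"
      using neg[of "real_smult (-t) x"] sublinear_scale[OF p(1) x, of "-t"] x False by simp
    finally show ?thesis .
  qed
  \<comment> \<open>Taking \<open>x\<close> itself in the infimum gives \<open>q x \<le> f x\<close>
    on \<open>M\<close>. The same inequality at the negative of \<open>x\<close> turns this into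
    equality, because \<open>p\<close> and \<open>f\<close> are odd.\<close>
  have le: "p x \<le> f x" if x: "x \<in> M" for x
  proof -
    have "p x \<le> q x" using p(2) by (rule le_funD)
    also have "\<dots> \<le> f x" using low[OF MC[OF x] x] MC[OF x] by (simp add: g_def a_minus_def r_neg)
    finally show ?thesis .
  qed
  have "p x = f x" if x: "x \<in> M" for x
    using le[OF x] le[OF M(4)[OF x, of "-1"]] f(2)[OF x, of "-1"] neg[OF MC[OF x]] by simp
  with add scale sublinearD(3)[OF p(1)] show ?thesis using that[of p] by auto
qed

text \<open>A complex linear functional is determined by its real part \<open>u\<close> through
  \<open>u x - \<i> * u (\<i> x)\<close>, so the real theorem is applied to the real part of
  \<open>f\<close>. The norm bound survives because a unimodular scalar rotates \<open>F x\<close>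
  onto the positive axis, where it equals its real part.\<close>

lemma hahn_banach:
  fixes f :: "'a \<Rightarrow> complex"
  assumes M: "M \<subseteq> carrier V" "M \<noteq> {}"
    "\<And>x y. x \<in> M \<Longrightarrow> y \<in> M \<Longrightarrow> x \<oplus>\<^bsub>V\<^esub> y \<in> M" "\<And>a x. x \<in> M \<Longrightarrow> a \<odot>\<^bsub>V\<^esub> x \<in> M"
    and f: "\<And>x y. x \<in> M \<Longrightarrow> y \<in> M \<Longrightarrow> f (x \<oplus>\<^bsub>V\<^esub> y) = f x + f y"
    "\<And>a x. x \<in> M \<Longrightarrow> f (a \<odot>\<^bsub>V\<^esub> x) = a * f x"
    "\<And>x. x \<in> M \<Longrightarrow> cmod (f x) \<le> \<parallel>x\<parallel>\<^bsub>V\<^esub>"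
  obtains F :: "'a \<Rightarrow> complex" where
    "\<And>x y. x \<in> carrier V \<Longrightarrow> y \<in> carrier V \<Longrightarrow> F (x \<oplus>\<^bsub>V\<^esub> y) = F x + F y"
    "\<And>a x. x \<in> carrier V \<Longrightarrow> F (a \<odot>\<^bsub>V\<^esub> x) = a * F x"
    "\<And>x. x \<in> carrier V \<Longrightarrow> cmod (F x) \<le> \<parallel>x\<parallel>\<^bsub>V\<^esub>"
    "\<And>x. x \<in> M \<Longrightarrow> F x = f x"
proof -
  have "\<bar>Re (f x)\<bar> \<le> \<parallel>x\<parallel>\<^bsub>V\<^esub>" if "x \<in> M" for x
    using abs_Re_le_cmod[of "f x"] f(3)[OF that] by simp
  then obtain u where u:
    "\<And>x y. x \<in> carrier V \<Longrightarrow> y \<in> carrier V \<Longrightarrow> u (x \<oplus>\<^bsub>V\<^esub> y) = u x + u y"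
    "\<And>t x. x \<in> carrier V \<Longrightarrow> u (real_smult t x) = t * u x"
    "\<And>x. x \<in> carrier V \<Longrightarrow> u x \<le> \<parallel>x\<parallel>\<^bsub>V\<^esub>"
    "\<And>x. x \<in> M \<Longrightarrow> u x = Re (f x)"
    using hahn_banach_real[of M "\<lambda>x. Re (f x)"] M f by (auto simp: real_smult_def)
  define F where "F x = Complex (u x) (- u (\<i> \<odot>\<^bsub>V\<^esub> x))" for x
  have add: "F (x \<oplus>\<^bsub>V\<^esub> y) = F x + F y" if "x \<in> carrier V" "y \<in> carrier V" for x y
    using that u(1) by (simp add: F_def smult_r_distr complex_eq_iff)
  have expand: "u (a \<odot>\<^bsub>V\<^esub> x) = Re a * u x + Im a * u (\<i> \<odot>\<^bsub>V\<^esub> x)" if x: "x \<in> carrier V" for a x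
  proof -
    have "a \<odot>\<^bsub>V\<^esub> x = real_smult (Re a) x \<oplus>\<^bsub>V\<^esub> real_smult (Im a) (\<i> \<odot>\<^bsub>V\<^esub> x)"
      using x by (simp add: real_smult_def smult_smult smult_add[symmetric] complex_eq[symmetric] mult.commute)
    then show ?thesis using u(1,2) x by simp
  qed
  have scale: "F (a \<odot>\<^bsub>V\<^esub> x) = a * F x" if x: "x \<in> carrier V" for a x
    using expand[OF x, of a] expand[OF x, of "\<i> * a"] x
    by (simp add: F_def smult_smult complex_eq_iff)
  have bound: "cmod (F x) \<le> \<parallel>x\<parallel>\<^bsub>V\<^esub>" if x: "x \<in> carrier V" for x
  proof (cases "F x = 0")
    case True
    then show ?thesis using vnorm_nonneg[OF x] by simp
  next
    case False
    define c where "c = cnj (F x) / cmod (F x)"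
    have c: "cmod c = 1" using False by (simp add: c_def norm_divide)
    have "c * F x = cmod (F x)"
      using False by (simp add: c_def complex_norm_square[symmetric] mult.commute power2_eq_square)
    then have "cmod (F x) = Re (F (c \<odot>\<^bsub>V\<^esub> x))" using scale[OF x] by simp
    also have "\<dots> = u (c \<odot>\<^bsub>V\<^esub> x)" by (simp add: F_def)
    also have "\<dots> \<le> \<parallel>x\<parallel>\<^bsub>V\<^esub>" using u(3)[of "c \<odot>\<^bsub>V\<^esub> x"] x c by (simp add: vnorm_smult)
    finally show ?thesis .
  qed
  have "F x = f x" if "x \<in> M" for x
    using that u(4) M f(2)[OF that, of \<i>] by (simp add: F_def complex_eq_iff)
  with add scale bound show ?thesis using that[of F] by auto
qed

end

section \<open>The Dirichlet kernel and its Lebesgue constants\<close>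

text \<open>The one-sided form differs from the symmetric kernel by the unimodular factor
  \<open>cis (d t / 2)\<close> and keeps the frequencies integral for odd \<open>d\<close> as
  well.\<close>

definition dirichlet :: "nat \<Rightarrow> real \<Rightarrow> complex" where
  "dirichlet d t = (\<Sum>k\<le>d. cis (real k * t))"

text \<open>Stated with the kernel instead of the quotient of sines, so that the integrand is
  continuous and periodic on the whole line.\<close>

definition lebesgue_const :: "nat \<Rightarrow> real" where
  "lebesgue_const d = 1 / (2 * pi) * integral {0..2 * pi} (\<lambda>t. cmod (dirichlet d t))"

lemma continuous_on_dirichlet [continuous_intros]: "continuous_on S (dirichlet d)"
  unfolding dirichlet_def by (intro continuous_intros)

lemma continuous_on_norm_dirichlet [continuous_intros]: "continuous_on S (\<lambda>t. cmod (dirichlet d t))"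
  by (intro continuous_intros)

lemma integrable_norm_dirichlet: "(\<lambda>t. cmod (dirichlet d t)) integrable_on {a..b}"
  by (intro integrable_continuous_interval continuous_intros)

lemma norm_dirichlet_le: "cmod (dirichlet d t) \<le> real d + 1"
  unfolding dirichlet_def using norm_sum[of "\<lambda>k. cis (real k * t)" "{..d}"] by simp

lemma cis_minus_1: "cis x - 1 = 2 * \<i> * sin (x / 2) * cis (x / 2)"
proof -
  have "cos x = 1 - 2 * sin (x / 2) ^ 2" "sin x = 2 * sin (x / 2) * cos (x / 2)"
    using cos_double_sin[of "x / 2"] sin_double[of "x / 2"] by simp_all
  then show ?thesis by (simp add: complex_eq_iff power2_eq_square)
qed

lemma norm_dirichlet:
  assumes "sin (t / 2) \<noteq> 0"
  shows "cmod (dirichlet d t) = \<bar>sin ((real d + 1) / 2 * t) / sin (t / 2)\<bar>"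
proof -
  have "dirichlet d t = (\<Sum>k<Suc d. cis t ^ k)"
    unfolding dirichlet_def lessThan_Suc_atMost by (intro sum.cong) (auto simp: Complex.DeMoivre)
  moreover have "cis ((real d + 1) * t) = cis t ^ Suc d"
    by (simp only: Complex.DeMoivre) (simp add: algebra_simps)
  ultimately have "(cis t - 1) * dirichlet d t = cis ((real d + 1) * t) - 1"
    by (simp only: power_diff_1_eq[of "cis t" "Suc d"])
  then have "cmod (cis t - 1) * cmod (dirichlet d t) = cmod (cis ((real d + 1) * t) - 1)"
    by (metis norm_mult)
  then have "\<bar>sin (t / 2)\<bar> * cmod (dirichlet d t) = \<bar>sin ((real d + 1) / 2 * t)\<bar>"
    by (simp add: cis_minus_1 norm_mult)
  then show ?thesis using assms by (simp add: field_simps)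
qed

lemma lebesgue_const_altdef:
  "lebesgue_const d = 1 / (2 * pi) * integral {0..2 * pi} (\<lambda>t. \<bar>sin ((real d + 1) / 2 * t) / sin (t / 2)\<bar>)"
proof -
  have "sin (t / 2) \<noteq> 0" if "t \<in> {0..2 * pi} - {0, 2 * pi}" for t
  proof -
    have "0 < sin (t / 2)" by (rule sin_gt_zero) (use that in auto)
    then show ?thesis by simp
  qed
  then have "integral {0..2 * pi} (\<lambda>t. cmod (dirichlet d t)) =
      integral {0..2 * pi} (\<lambda>t. \<bar>sin ((real d + 1) / 2 * t) / sin (t / 2)\<bar>)"
    \<comment> \<open>At the two endpoints the denominator vanishes and the quotient has the default
      value 0, whereas the kernel has modulus \<open>d + 1\<close>; two points do not affect the
      integral.\<close>
    by (intro integral_spike[where S = "{0, 2 * pi}"]) (auto simp: norm_dirichlet)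
  then show ?thesis by (simp add: lebesgue_const_def)
qed

lemma norm_dirichlet_reflect: "cmod (dirichlet d (2 * pi - t)) = cmod (dirichlet d t)"
proof -
  have "dirichlet d (2 * pi - t) = cnj (dirichlet d t)"
    unfolding dirichlet_def cnj_sum
  proof (rule sum.cong)
    fix k
    have "cis (real k * (2 * pi - t)) = cis (2 * pi * real k) * cis (- (real k * t))"
      by (simp add: cis_mult algebra_simps)
    then show "cis (real k * (2 * pi - t)) = cnj (cis (real k * t))"
      by (simp add: cis_cnj cis_multiple_2pi)
  qed simp
  then show ?thesis by simp
qed

text \<open>On half the period \<open>sin (t / 2)\<close> vanishes only at 0, so it can be compared
  with \<open>t / 2\<close> from both sides.\<close>

lemma lebesgue_const_eq_half: "lebesgue_const d = 1 / pi * integral {0..pi} (\<lambda>t. cmod (dirichlet d t))"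
proof -
  let ?f = "\<lambda>t. cmod (dirichlet d t)"
  have "integral {pi..2 * pi} ?f = integral {0..pi} ?f"
  proof -
    have "(?f has_integral integral {0..pi} ?f) {0..pi}"
      using integrable_norm_dirichlet by (rule integrable_integral)
    then have "(?f has_integral integral {0..pi} ?f) (cbox 0 pi)" by simp
    from has_integral_affinity[OF this, of "-1" "2 * pi"]
    have "((\<lambda>t. ?f (2 * pi - t)) has_integral integral {0..pi} ?f)
        ((\<lambda>x. 2 * pi - x) ` {0..pi})"
      by simp
    moreover have "(\<lambda>x. 2 * pi - x) ` {0..pi} = {pi..2 * pi}"
      by (subst image_diff_atLeastAtMost) simp
    ultimately show ?thesis by (simp add: norm_dirichlet_reflect integral_unique)
  qed
  moreover have "integral {0..pi} ?f + integral {pi..2 * pi} ?f = integral {0..2 * pi} ?f"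
    by (rule Henstock_Kurzweil_Integration.integral_combine) (auto intro: integrable_norm_dirichlet)
  ultimately show ?thesis by (simp add: lebesgue_const_def field_simps)
qed

section \<open>Two-sided bounds for the Lebesgue constants by arches of the sine\<close>

lemma integral_sum_intervals:
  fixes g :: "real \<Rightarrow> real"
  assumes "h \<ge> 0" "a \<le> m" "g integrable_on {real a * h..real m * h}"
  shows "integral {real a * h..real m * h} g = (\<Sum>k=a..<m. integral {real k * h..real (Suc k) * h} g)"
  using assms(2,3)
proof (induction m rule: dec_induct)
  case base
  then show ?case by simp
next
  case (step m)
  have le: "real a * h \<le> real m * h" "real m * h \<le> real (Suc m) * h"
    using step(1) assms(1) by (intro mult_right_mono; simp)+
  have "g integrable_on {real a * h..real m * h}"
    by (rule integrable_on_subinterval[OF step.prems]) (use le in auto)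
  moreover have "integral {real a * h..real m * h} g + integral {real m * h..real (Suc m) * h} g =
      integral {real a * h..real (Suc m) * h} g"
    by (rule Henstock_Kurzweil_Integration.integral_combine) (use le step.prems in auto)
  ultimately show ?case using step by simp
qed

text \<open>Between consecutive zeros the sine has the constant sign \<open>(-1) ^ k\<close>, so its
  modulus has an elementary primitive there. Each arch has area 2, scaled by
  \<open>1 / c\<close>.\<close>

lemma integral_abs_sin:
  assumes "c > 0"
  shows "((\<lambda>t. \<bar>sin (c * t)\<bar>) has_integral 2 / c) {real k * (pi / c)..real (Suc k) * (pi / c)}"
proof -
  let ?F = "\<lambda>t. - ((-1) ^ k * cos (c * t) / c)"
  have "((\<lambda>t. (-1) ^ k * sin (c * t)) has_integral
      (?F (real (Suc k) * (pi / c)) - ?F (real k * (pi / c))))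
      {real k * (pi / c)..real (Suc k) * (pi / c)}"
  proof (rule fundamental_theorem_of_calculus)
    show "real k * (pi / c) \<le> real (Suc k) * (pi / c)"
      using assms by (intro mult_right_mono) auto
    show "(?F has_vector_derivative (-1) ^ k * sin (c * t))
        (at t within {real k * (pi / c)..real (Suc k) * (pi / c)})" for t
      unfolding has_real_derivative_iff_has_vector_derivative[symmetric]
      by (rule derivative_eq_intros refl | use assms in simp)+
  qed
  also have "?F (real (Suc k) * (pi / c)) - ?F (real k * (pi / c)) = 2 / c"
  proof -
    have "c * (real (Suc k) * (pi / c)) = real (Suc k) * pi" "c * (real k * (pi / c)) = real k * pi"
      using assms by auto
    then show ?thesis
      by (simp only: cos_npi) (simp add: field_simps power_mult_distrib[symmetric])
  qed
  finally have I: "((\<lambda>t. (-1) ^ k * sin (c * t)) has_integral 2 / c)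
      {real k * (pi / c)..real (Suc k) * (pi / c)}" .
  have "(-1) ^ k * sin (c * t) = \<bar>sin (c * t)\<bar>"
    if t: "t \<in> {real k * (pi / c)..real (Suc k) * (pi / c)}" for t
  proof -
    define y where "y = c * t - real k * pi"
    have "0 \<le> y" "y \<le> pi" using t assms by (auto simp: y_def field_simps)
    then have "sin y \<ge> 0" by (intro sin_ge_zero)
    moreover have "sin (c * t) = (-1) ^ k * sin y"
      using sin_add[of y "real k * pi"] by (simp add: y_def mult.commute)
    ultimately show ?thesis by (simp add: abs_mult power_mult_distrib[symmetric])
  qed
  then show ?thesis using I by (rule has_integral_eq)
qed

lemma harm_sum: "harm m = (\<Sum>k<m. 1 / (real k + 1))"
  by (simp add: harm_altdef inverse_eq_divide add.commute)

text \<open>The zeros of the numerator have distance \<open>h\<close>, and \<open>m\<close> full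
  arches fit into the interval from 0 to \<pi>. On arch \<open>k\<close> the denominator is at most
  \<open>t / 2 \<le> pi * (k + 1) / n\<close>, and the arch of the numerator has area
  \<open>4 / n\<close>, so its contribution is at least \<open>4 / (pi * (k + 1))\<close>. The rest
  of the interval is dropped.\<close>

lemma lebesgue_const_lower:
  assumes "m = (d + 1) div 2"
  shows "4 / pi\<^sup>2 * harm m \<le> lebesgue_const d"
proof -
  define n where "n = real d + 1"
  define h where "h = pi / (n / 2)"
  have n: "n > 0" by (simp add: n_def)
  have h: "h > 0" using n by (simp add: h_def)
  have mh: "real m * h \<le> pi"
  proof -
    have "2 * m \<le> d + 1" using assms by simp
    then have "2 * real m \<le> n" by (simp add: n_def)
    then show ?thesis using n by (simp add: h_def field_simps)
  qed
  have piece: "4 / (pi * (real k + 1)) \<le> integral {real k * h..real (Suc k) * h} (\<lambda>t. cmod (dirichlet d t))"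
    if k: "k < m" for k
  proof -
    have "((\<lambda>t. n / (pi * (real k + 1)) * \<bar>sin (n / 2 * t)\<bar>) has_integral
        n / (pi * (real k + 1)) * (2 / (n / 2))) {real k * h..real (Suc k) * h}"
      using integral_abs_sin[of "n / 2" k] n unfolding h_def by (intro has_integral_mult_right) simp
    then have *: "((\<lambda>t. n / (pi * (real k + 1)) * \<bar>sin (n / 2 * t)\<bar>) has_integral
        4 / (pi * (real k + 1))) {real k * h..real (Suc k) * h}"
      using n by (simp add: field_simps)
    show ?thesis
    proof (rule has_integral_le[OF * integrable_integral[OF integrable_norm_dirichlet]])
      fix t assume t: "t \<in> {real k * h..real (Suc k) * h}"
      have "real k * h \<ge> 0" using h by simp
      then have t0: "t \<ge> 0" using t by simp
      have "real (Suc k) * h \<le> real m * h" using k h by (intro mult_right_mono) auto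
      then have tpi: "t \<le> pi" using t mh by simp
      show "n / (pi * (real k + 1)) * \<bar>sin (n / 2 * t)\<bar> \<le> cmod (dirichlet d t)"
      proof (cases "t = 0")
        case False
        then have tp: "t > 0" using t0 by simp
        have s: "sin (t / 2) > 0" by (rule sin_gt_zero) (use tp tpi in auto)
        have "sin (t / 2) \<le> t / 2" using t0 by (intro sin_x_le_x) simp
        also have "\<dots> \<le> pi * (real k + 1) / n" using t n by (simp add: h_def field_simps)
        finally have sle: "sin (t / 2) \<le> pi * (real k + 1) / n" .
        have "n / (pi * (real k + 1)) = 1 / (pi * (real k + 1) / n)" by simp
        also have "\<dots> \<le> 1 / sin (t / 2)" by (rule divide_left_mono[OF sle]) (use s n in auto)
        finally have "n / (pi * (real k + 1)) \<le> 1 / sin (t / 2)" .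
        then have "n / (pi * (real k + 1)) * \<bar>sin (n / 2 * t)\<bar> \<le> 1 / sin (t / 2) * \<bar>sin (n / 2 * t)\<bar>"
          by (intro mult_right_mono) auto
        also have "\<dots> = cmod (dirichlet d t)" using s by (simp add: norm_dirichlet n_def)
        finally show ?thesis .
      qed simp
    qed
  qed
  have "4 / pi * harm m = (\<Sum>k<m. 4 / (pi * (real k + 1)))"
    by (simp add: harm_sum sum_distrib_left)
  also have "\<dots> \<le> (\<Sum>k<m. integral {real k * h..real (Suc k) * h} (\<lambda>t. cmod (dirichlet d t)))"
    by (rule sum_mono) (use piece in auto)
  also have "\<dots> = integral {0..real m * h} (\<lambda>t. cmod (dirichlet d t))"
    using integral_sum_intervals[of h 0 m "\<lambda>t. cmod (dirichlet d t)"] h integrable_norm_dirichlet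
    by (simp add: atLeast0LessThan)
  also have "\<dots> \<le> integral {0..pi} (\<lambda>t. cmod (dirichlet d t))"
    by (rule integral_subset_le) (use mh integrable_norm_dirichlet in auto)
  finally have "1 / pi * (4 / pi * harm m) \<le> lebesgue_const d"
    unfolding lebesgue_const_eq_half by (intro mult_left_mono) auto
  then show ?thesis by (simp add: power2_eq_square)
qed

text \<open>The bounded error 1 is all that matters: it contributes only a constant to the Lebesgue
  constant, while \<open>1 / x\<close> carries the logarithm.\<close>

lemma inverse_sin_le:
  fixes x :: real
  assumes "0 < x" "x \<le> pi / 2"
  shows "1 / sin x \<le> 1 / x + 1"
proof -
  have x2: "x \<le> 2" using assms pi_half_less_two by linarith
  have "\<bar>sin x - (\<Sum>m<3. sin_coeff m * x ^ m)\<bar> \<le> inverse (fact 3) * \<bar>x\<bar> ^ 3"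
    by (rule Maclaurin_sin_bound)
  then have "\<bar>sin x - x\<bar> \<le> x ^ 3 / 6"
    using assms by (simp add: numeral_eq_Suc sin_coeff_def field_simps)
  then have s: "x - x ^ 3 / 6 \<le> sin x" by linarith
  \<comment> \<open>This product is six times the difference of
    \<open>(x - x ^ 3 / 6) * (1 + x)\<close> and \<open>x\<close>.\<close>
  have "0 \<le> x\<^sup>2 * (2 - x) * (x + 3)" using assms x2 by simp
  then have "x \<le> (x - x ^ 3 / 6) * (1 + x)"
    by (simp add: algebra_simps power2_eq_square power3_eq_cube)
  also have "\<dots> \<le> sin x * (1 + x)" using s assms by (intro mult_right_mono) auto
  finally have *: "x \<le> sin x * (1 + x)" .
  have "sin x > 0" by (rule sin_gt_zero) (use assms in auto)
  then show ?thesis using * assms by (simp add: field_simps)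
qed

text \<open>On the arches after the first, the denominator is replaced by its value at the left end,
  up to the error of \<open>inverse_sin_le\<close>. The constant 3 collects \<open>2 * pi\<close>
  from the first arch and at most \<open>pi\<close> from the error, divided by
  \<open>pi\<close>.\<close>

lemma lebesgue_const_upper:
  assumes "m = (d + 1) div 2" "d \<ge> 1"
  shows "lebesgue_const d \<le> 4 / pi\<^sup>2 * harm m + 3"
proof -
  define n where "n = real d + 1"
  define h where "h = pi / (n / 2)"
  define g where "g t = \<bar>sin (n / 2 * t)\<bar> * (2 / t)" for t
  have n: "n \<ge> 2" using assms by (simp add: n_def)
  have h: "h > 0" using n by (simp add: h_def)
  have hpi: "h \<le> pi" using n by (simp add: h_def field_simps)
  have mh: "pi \<le> real (Suc m) * h"
  proof -
    have "d + 1 \<le> 2 * Suc m" using assms by simp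
    then have "n \<le> 2 * real (Suc m)" unfolding n_def by linarith
    then have "1 \<le> 2 * real (Suc m) / n" using n by (simp only: le_divide_eq) simp
    then have "pi * 1 \<le> pi * (2 * real (Suc m) / n)" by (intro mult_left_mono) auto
    then show ?thesis by (simp add: h_def mult_ac)
  qed
  have g_int: "g integrable_on {a..b}" if "a > 0" for a b
    unfolding g_def by (intro integrable_continuous_interval continuous_intros) (use that in auto)
  \<comment> \<open>The left end of the first arch is 0, so the comparison with \<open>2 / t\<close>
    is useless there; the trivial bound \<open>n\<close> over length \<open>h\<close> costs only a
    constant.\<close>
  have "integral {0..h} (\<lambda>t. cmod (dirichlet d t)) \<le> n * h"
    using integral_le[OF integrable_norm_dirichlet, of "\<lambda>_. n" 0 h d] norm_dirichlet_le h
    by (simp add: n_def mult.commute integrable_on_const)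
  also have "\<dots> = 2 * pi" using n by (simp add: h_def)
  finally have I1: "integral {0..h} (\<lambda>t. cmod (dirichlet d t)) \<le> 2 * pi" .
  have "integral {h..pi} (\<lambda>t. cmod (dirichlet d t)) \<le> integral {h..pi} (\<lambda>t. g t + 1)"
  proof (rule integral_le[OF integrable_norm_dirichlet])
    show "(\<lambda>t. g t + 1) integrable_on {h..pi}" using g_int[OF h] by (intro integrable_add) auto
    fix t assume t: "t \<in> {h..pi}"
    have s: "sin (t / 2) > 0" by (rule sin_gt_zero) (use t h in auto)
    have "cmod (dirichlet d t) = \<bar>sin (n / 2 * t)\<bar> * (1 / sin (t / 2))"
      using s by (simp add: norm_dirichlet n_def)
    also have "\<dots> \<le> \<bar>sin (n / 2 * t)\<bar> * (1 / (t / 2) + 1)"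
      by (intro mult_left_mono inverse_sin_le) (use t h in auto)
    also have "\<dots> \<le> g t + 1" by (simp add: g_def algebra_simps)
    finally show "cmod (dirichlet d t) \<le> g t + 1" .
  qed
  also have "\<dots> = integral {h..pi} g + (pi - h)"
    using g_int[OF h, of pi] hpi by (simp add: integral_add integrable_on_const)
  \<comment> \<open>Since \<open>g\<close> is nonnegative, the domain may be enlarged beyond \<pi>
    so that it consists of complete arches.\<close>
  also have "\<dots> \<le> integral {h..real (Suc m) * h} g + pi"
    by (intro add_mono integral_subset_le) (use g_int[OF h] mh h in \<open>auto simp: g_def\<close>)
  also have "integral {h..real (Suc m) * h} g = (\<Sum>k=1..<Suc m. integral {real k * h..real (Suc k) * h} g)"
    using integral_sum_intervals[of h 1 "Suc m" g] h g_int[OF h] by simp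
  also have "\<dots> \<le> (\<Sum>k=1..<Suc m. 4 / (pi * real k))"
  proof (rule sum_mono)
    fix k assume k: "k \<in> {1..<Suc m}"
    have kh: "real k * h > 0" using k h by simp
    have "((\<lambda>t. n / (pi * real k) * \<bar>sin (n / 2 * t)\<bar>) has_integral
        n / (pi * real k) * (2 / (n / 2))) {real k * h..real (Suc k) * h}"
      using integral_abs_sin[of "n / 2" k] n unfolding h_def by (intro has_integral_mult_right) simp
    then have *: "((\<lambda>t. n / (pi * real k) * \<bar>sin (n / 2 * t)\<bar>) has_integral
        4 / (pi * real k)) {real k * h..real (Suc k) * h}"
      using n by (simp add: field_simps)
    show "integral {real k * h..real (Suc k) * h} g \<le> 4 / (pi * real k)"
    proof (rule has_integral_le[OF integrable_integral[OF g_int[OF kh]] *])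
      fix t assume t: "t \<in> {real k * h..real (Suc k) * h}"
      have "2 / t \<le> 2 / (real k * h)" using t kh by (intro divide_left_mono) auto
      also have "\<dots> = n / (pi * real k)" using n by (simp add: h_def)
      finally show "g t \<le> n / (pi * real k) * \<bar>sin (n / 2 * t)\<bar>"
        unfolding g_def by (subst mult.commute, intro mult_right_mono) auto
    qed
  qed
  also have "\<dots> = (\<Sum>k<m. 4 / (pi * (real k + 1)))"
    by (rule sum.reindex_bij_witness[of _ Suc "\<lambda>k. k - 1"]) auto
  also have "\<dots> = 4 / pi * harm m"
    by (simp add: harm_sum sum_distrib_left)
  finally have I2: "integral {h..pi} (\<lambda>t. cmod (dirichlet d t)) \<le> 4 / pi * harm m + pi" by simp
  have "integral {0..pi} (\<lambda>t. cmod (dirichlet d t)) =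
      integral {0..h} (\<lambda>t. cmod (dirichlet d t)) + integral {h..pi} (\<lambda>t. cmod (dirichlet d t))"
    using h hpi
    by (intro Henstock_Kurzweil_Integration.integral_combine[symmetric] integrable_norm_dirichlet) auto
  then have "integral {0..pi} (\<lambda>t. cmod (dirichlet d t)) \<le> 4 / pi * harm m + 3 * pi"
    using I1 I2 by simp
  then have "lebesgue_const d \<le> 1 / pi * (4 / pi * harm m + 3 * pi)"
    unfolding lebesgue_const_eq_half by (intro mult_left_mono) auto
  also have "\<dots> = 4 / pi\<^sup>2 * harm m + 3" by (simp add: power2_eq_square field_simps)
  finally show ?thesis .
qed

lemma harm_le_ln:
  assumes "m \<ge> 1"
  shows "harm m \<le> ln (real m) + 1"
proof -
  obtain k where k: "m = Suc k" using assms by (cases m) auto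
  show ?thesis using decseqD[OF decseq_harm_diff_ln, of 0 k] by (simp add: k harm_expand)
qed

text \<open>The index \<open>m\<close> is about \<open>d / 2\<close>. Estimating
  \<open>harm m\<close> below by \<open>ln (d / 2)\<close> and above by \<open>ln d + 1\<close>
  loses only a bounded amount, which disappears after division by \<open>ln d\<close>.\<close>

lemma lebesgue_const_asymptotics: "(\<lambda>d. lebesgue_const d / ln (real d)) \<longlonglongrightarrow> 4 / pi\<^sup>2"
proof (rule tendsto_sandwich)
  show "\<forall>\<^sub>F d in sequentially. 4 / pi\<^sup>2 * (ln (real d) - ln 2) / ln (real d) \<le> lebesgue_const d / ln (real d)"
    using eventually_ge_at_top[of 2]
  proof eventually_elim
    case (elim d)
    define m where "m = (d + 1) div 2"
    have "d \<le> 2 * (m + 1)" by (simp add: m_def)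
    then have "real d \<le> real (2 * (m + 1))" by (simp only: of_nat_mono)
    then have "real d / 2 \<le> real m + 1" by simp
    then have "ln (real d / 2) \<le> ln (real m + 1)" using elim by (intro ln_mono) auto
    also have "\<dots> \<le> harm m" by (rule harm_ge_ln)
    finally have "ln (real d) - ln 2 \<le> harm m" using elim by (simp add: ln_div)
    then have "4 / pi\<^sup>2 * (ln (real d) - ln 2) \<le> 4 / pi\<^sup>2 * harm m"
      by (intro mult_left_mono) auto
    also have "\<dots> \<le> lebesgue_const d" by (rule lebesgue_const_lower) (simp add: m_def)
    finally show ?case using elim by (intro divide_right_mono) auto
  qed
  show "\<forall>\<^sub>F d in sequentially. lebesgue_const d / ln (real d) \<le> (4 / pi\<^sup>2 * (ln (real d) + 1) + 3) / ln (real d)"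
    using eventually_ge_at_top[of 2]
  proof eventually_elim
    case (elim d)
    define m where "m = (d + 1) div 2"
    have m: "1 \<le> m" "m \<le> d" using elim by (auto simp: m_def)
    have "lebesgue_const d \<le> 4 / pi\<^sup>2 * harm m + 3" by (rule lebesgue_const_upper) (use elim in \<open>auto simp: m_def\<close>)
    also have "4 / pi\<^sup>2 * harm m \<le> 4 / pi\<^sup>2 * (ln (real d) + 1)"
    proof (rule mult_left_mono)
      have "harm m \<le> ln (real m) + 1" using m by (intro harm_le_ln)
      also have "ln (real m) \<le> ln (real d)" using m by simp
      finally show "harm m \<le> ln (real d) + 1" by simp
    qed simp
    finally have "lebesgue_const d \<le> 4 / pi\<^sup>2 * (ln (real d) + 1) + 3" by simp
    then show ?case using elim by (intro divide_right_mono) auto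
  qed
  show "(\<lambda>d. 4 / pi\<^sup>2 * (ln (real d) - ln 2) / ln (real d)) \<longlonglongrightarrow> 4 / pi\<^sup>2"
    by real_asymp
  show "(\<lambda>d. (4 / pi\<^sup>2 * (ln (real d) + 1) + 3) / ln (real d)) \<longlonglongrightarrow> 4 / pi\<^sup>2"
    by real_asymp
qed

section \<open>Equidistant nodes and trigonometric polynomials\<close>

abbreviation node :: "nat \<Rightarrow> nat \<Rightarrow> real" where "node N j \<equiv> 2 * pi * real j / real N"

text \<open>Discrete orthogonality: a geometric sum of an \<open>N\<close>-th root of unity. The
  bound on \<open>m\<close> rules out the nonzero multiples of \<open>N\<close>, which the nodes
  cannot distinguish from frequency 0.\<close>

lemma sum_cis_nodes:
  fixes m :: int
  assumes "\<bar>m\<bar> < int N"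
  shows "(\<Sum>j<N. cis (of_int m * node N j)) = (if m = 0 then of_nat N else 0)"
proof (cases "m = 0")
  case False
  define w where "w = cis (of_int m * (2 * pi / real N))"
  have N: "N > 0" using assms by linarith
  have "w ^ N = cis (2 * pi * of_int m)"
    using N by (simp add: w_def Complex.DeMoivre mult_ac)
  then have wN: "w ^ N = 1" by (simp add: cis_multiple_2pi)
  have "w \<noteq> 1"
  proof
    assume "w = 1"
    then have "cos (of_int m * (2 * pi / real N)) = 1" by (simp add: w_def complex_eq_iff)
    then obtain k :: int where "of_int m * (2 * pi / real N) = of_int k * 2 * pi"
      by (auto simp: cos_one_2pi_int)
    then have "real_of_int m = of_int k * real N" using N by (simp add: field_simps)
    then have "m = k * int N" by (metis of_int_eq_iff of_int_mult of_int_of_nat_eq)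
    then have "\<bar>m\<bar> = \<bar>k\<bar> * int N" by (simp add: abs_mult)
    moreover have "\<bar>k\<bar> \<ge> 1" using False \<open>m = k * int N\<close> by auto
    then have "1 * int N \<le> \<bar>k\<bar> * int N" by (intro mult_right_mono) auto
    ultimately show False using assms by simp
  qed
  have "(\<Sum>j<N. cis (of_int m * node N j)) = (\<Sum>j<N. w ^ j)"
    by (simp add: w_def Complex.DeMoivre mult_ac)
  also have "\<dots> = 0" using \<open>w \<noteq> 1\<close> wN by (simp add: sum_gp_strict)
  finally show ?thesis using False by simp
qed simp

lemma dirichlet_periodic: "dirichlet d (t + 2 * pi * of_int k) = dirichlet d t"
  unfolding dirichlet_def
proof (rule sum.cong)
  fix j
  have "cis (real j * (t + 2 * pi * of_int k)) = cis (real j * t) * cis (2 * pi * of_int (int j * k))"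
    by (simp add: cis_mult algebra_simps)
  then show "cis (real j * (t + 2 * pi * of_int k)) = cis (real j * t)"
    by (simp add: cis_multiple_2pi del: of_int_mult)
qed simp

lemma norm_dirichlet_uminus: "cmod (dirichlet d (- t)) = cmod (dirichlet d t)"
proof -
  have "dirichlet d (- t) = cnj (dirichlet d t)" by (simp add: dirichlet_def cis_cnj)
  then show ?thesis by simp
qed

lemma norm_cis_diff_le: "cmod (cis a - cis b) \<le> \<bar>a - b\<bar>"
proof -
  have "cis a - cis b = cis b * (cis (a - b) - 1)"
    by (simp add: algebra_simps cis_mult)
  then have "cmod (cis a - cis b) = 2 * \<bar>sin ((a - b) / 2)\<bar>"
    by (simp add: cis_minus_1 norm_mult)
  also have "\<dots> \<le> 2 * \<bar>(a - b) / 2\<bar>" by (intro mult_left_mono abs_sin_x_le_abs_x) auto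
  finally show ?thesis by simp
qed

lemma norm_dirichlet_lipschitz:
  "\<bar>cmod (dirichlet d s) - cmod (dirichlet d t)\<bar> \<le> real d * (real d + 1) * \<bar>s - t\<bar>"
proof -
  have "\<bar>cmod (dirichlet d s) - cmod (dirichlet d t)\<bar> \<le> cmod (dirichlet d s - dirichlet d t)"
    by (rule norm_triangle_ineq3)
  also have "\<dots> = cmod (\<Sum>k\<le>d. cis (real k * s) - cis (real k * t))"
    by (simp add: dirichlet_def sum_subtractf)
  also have "\<dots> \<le> (\<Sum>k\<le>d. real d * \<bar>s - t\<bar>)"
  proof (rule sum_norm_le)
    fix k assume "k \<in> {..d}"
    have "cmod (cis (real k * s) - cis (real k * t)) \<le> \<bar>real k * s - real k * t\<bar>"
      by (rule norm_cis_diff_le)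
    also have "\<dots> = real k * \<bar>s - t\<bar>" by (simp add: abs_mult flip: right_diff_distrib)
    also have "\<dots> \<le> real d * \<bar>s - t\<bar>" using \<open>k \<in> {..d}\<close> by (intro mult_right_mono) auto
    finally show "cmod (cis (real k * s) - cis (real k * t)) \<le> real d * \<bar>s - t\<bar>" .
  qed
  also have "\<dots> = real d * (real d + 1) * \<bar>s - t\<bar>" by (simp add: algebra_simps)
  finally show ?thesis .
qed

text \<open>With \<open>u\<close> the residue of \<open>s\<close> modulo \<open>2 * pi\<close>, the
  shifted period is cut at \<open>2 * pi\<close> and its tail is moved back by one period.\<close>

lemma integral_norm_dirichlet_shift:
  "integral {0..2 * pi} (\<lambda>t. cmod (dirichlet d (s + t))) = 2 * pi * lebesgue_const d"
proof -
  define u where "u = s - 2 * pi * of_int \<lfloor>s / (2 * pi)\<rfloor>"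
  let ?f = "\<lambda>t. cmod (dirichlet d t)"
  note comb = Henstock_Kurzweil_Integration.integral_combine
  have u: "0 \<le> u" "u \<le> 2 * pi"
    using floor_divide_lower[of "2 * pi" s] floor_divide_upper[of "2 * pi" s]
    by (auto simp: u_def algebra_simps)
  have "dirichlet d (s + t) = dirichlet d (u + t)" for t
    using dirichlet_periodic[of d "u + t" "\<lfloor>s / (2 * pi)\<rfloor>"] by (simp add: u_def algebra_simps)
  then have "integral {0..2 * pi} (\<lambda>t. cmod (dirichlet d (s + t))) = integral {0..2 * pi} (?f \<circ> (+) u)"
    by (simp add: o_def)
  also have "\<dots> = integral {u..2 * pi + u} ?f"
    by (subst integral_shift_Icc_real) simp
  also have "\<dots> = integral {u..2 * pi} ?f + integral {2 * pi..2 * pi + u} ?f"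
    using u by (intro comb[symmetric] integrable_norm_dirichlet) auto
  also have "integral {2 * pi..2 * pi + u} ?f = integral {0..u} (?f \<circ> (+) (2 * pi))"
    by (subst integral_shift_Icc_real) (simp add: add.commute)
  also have "?f \<circ> (+) (2 * pi) = ?f"
    using dirichlet_periodic[of d _ 1] by (simp add: o_def add.commute)
  also have "integral {u..2 * pi} ?f + integral {0..u} ?f = integral {0..2 * pi} ?f"
    using u comb[of 0 u "2 * pi" ?f] integrable_norm_dirichlet by simp
  finally show ?thesis by (simp add: lebesgue_const_def)
qed

lemma two_pi_pos: "0 < 2 * pi" by simp

text \<open>A Riemann sum with \<open>N\<close> cells of width \<open>h\<close> for a function with
  Lipschitz constant \<open>L\<close>: each cell costs at most \<open>L * h * h\<close>. The bound
  is uniform in \<open>s\<close>, as needed when the supremum over all points of the circle is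
  taken.\<close>

lemma mean_norm_dirichlet_nodes:
  assumes N: "N > 0"
  shows "\<bar>(\<Sum>j<N. cmod (dirichlet d (s + node N j))) / N - lebesgue_const d\<bar> \<le> 2 * pi * (real d * (real d + 1)) / N"
proof -
  define h where "h = 2 * pi / real N"
  define L where "L = real d * (real d + 1)"
  define f where "f t = cmod (dirichlet d (s + t))" for t
  have h: "h > 0" using N by (simp add: h_def)
  have int: "f integrable_on {a..b}" for a b
    unfolding f_def by (intro integrable_continuous_interval continuous_on_compose2[OF continuous_on_norm_dirichlet[of UNIV]] continuous_intros) auto
  have piece: "\<bar>h * f (real k * h) - integral {real k * h..real (Suc k) * h} f\<bar> \<le> L * h * h" for k
  proof -
    have "h * f (real k * h) - integral {real k * h..real (Suc k) * h} f =
        integral {real k * h..real (Suc k) * h} (\<lambda>t. f (real k * h) - f t)"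
      using h by (subst integral_diff) (auto simp: int integrable_on_const algebra_simps)
    also have "norm \<dots> \<le> (L * h) * (real (Suc k) * h - real k * h)"
    proof (rule integral_bound)
      show "continuous_on {real k * h..real (Suc k) * h} (\<lambda>t. f (real k * h) - f t)"
        unfolding f_def
        by (intro continuous_on_compose2[OF continuous_on_norm_dirichlet[of UNIV]] continuous_intros) auto
      fix t assume t: "t \<in> {real k * h..real (Suc k) * h}"
      have "norm (f (real k * h) - f t) \<le> L * \<bar>(s + real k * h) - (s + t)\<bar>"
        unfolding f_def L_def real_norm_def by (rule norm_dirichlet_lipschitz)
      also have "\<dots> \<le> L * h"
        using t by (intro mult_left_mono) (auto simp: L_def algebra_simps)
      finally show "norm (f (real k * h) - f t) \<le> L * h" .
    qed (use h in simp)
    finally show ?thesis by (simp add: algebra_simps)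
  qed
  have "2 * pi * lebesgue_const d = integral {0..real N * h} f"
    using integral_norm_dirichlet_shift[of d s] N by (simp add: f_def[abs_def] h_def)
  also have "\<dots> = (\<Sum>k<N. integral {real k * h..real (Suc k) * h} f)"
    using integral_sum_intervals[of h 0 N f] int h by (simp add: atLeast0LessThan)
  finally have "(\<Sum>k<N. h * f (real k * h)) - 2 * pi * lebesgue_const d =
      (\<Sum>k<N. h * f (real k * h) - integral {real k * h..real (Suc k) * h} f)"
    by (simp add: sum_subtractf)
  also have "\<bar>\<dots>\<bar> \<le> (\<Sum>k<N. L * h * h)"
    by (rule order_trans[OF sum_abs]) (intro sum_mono piece)
  also have "\<dots> = 2 * pi * (2 * pi * L / N)" using N by (simp add: h_def)
  also have "(\<Sum>k<N. h * f (real k * h)) = 2 * pi * ((\<Sum>j<N. cmod (dirichlet d (s + node N j))) / N)"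
    by (simp add: h_def f_def sum_distrib_left sum_divide_distrib mult_ac)
  finally have "\<bar>2 * pi * ((\<Sum>j<N. cmod (dirichlet d (s + node N j))) / N - lebesgue_const d)\<bar> \<le> 2 * pi * (2 * pi * L / N)"
    by (simp only: right_diff_distrib)
  then have "2 * pi * \<bar>(\<Sum>j<N. cmod (dirichlet d (s + node N j))) / N - lebesgue_const d\<bar> \<le> 2 * pi * (2 * pi * L / N)"
    by (simp only: abs_mult) simp
  then show ?thesis by (simp only: L_def mult_le_cancel_left_pos[OF two_pi_pos])
qed

section \<open>Trigonometric polynomials and approximation of the phase of the kernel\<close>

inductive trig_poly :: "(real \<Rightarrow> complex) \<Rightarrow> bool" where
  monomial: "trig_poly (\<lambda>t. c * cis (of_int k * t))"
| add: "trig_poly f \<Longrightarrow> trig_poly g \<Longrightarrow> trig_poly (\<lambda>t. f t + g t)"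

lemma trig_poly_const: "trig_poly (\<lambda>t. c)"
  using monomial[of c 0] by simp

lemma trig_poly_mult: "trig_poly f \<Longrightarrow> trig_poly g \<Longrightarrow> trig_poly (\<lambda>t. f t * g t)"
proof (induction rule: trig_poly.induct)
  case (monomial c k)
  from monomial show ?case
  proof (induction rule: trig_poly.induct)
    case (monomial c' k')
    have "trig_poly (\<lambda>t. (c * c') * cis (of_int (k + k') * t))" by (rule trig_poly.monomial)
    then show ?case by (simp add: cis_mult[symmetric] algebra_simps)
  next
    case (add f g)
    then show ?case by (simp add: distrib_left trig_poly.add)
  qed
next
  case (add f g)
  then show ?case by (simp add: distrib_right trig_poly.add)
qed

lemma trig_poly_real_polynomial_function:
  "real_polynomial_function p \<Longrightarrow> trig_poly (\<lambda>t. complex_of_real (p (cis t)))"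
proof (induction rule: real_polynomial_function.induct)
  case (linear f)
  interpret bounded_linear f by fact
  have lin: "f z = Re z * f 1 + Im z * f \<i>" for z
  proof -
    have "f (Re z *\<^sub>R 1 + Im z *\<^sub>R \<i>) = Re z * f 1 + Im z * f \<i>"
      by (simp only: add scaleR real_scaleR_def)
    moreover have "Re z *\<^sub>R 1 + Im z *\<^sub>R \<i> = z" by (simp add: complex_eq_iff)
    ultimately show ?thesis by simp
  qed
  \<comment> \<open>A real linear form in \<open>cos t\<close> and \<open>sin t\<close>, rewritten
    by Euler's formulas; frequency -1 occurs here, so \<open>trig_poly\<close> must admit negative
    frequencies.\<close>
  have "complex_of_real (f (cis t)) =
      ((f 1 - \<i> * f \<i>) / 2) * cis (of_int 1 * t) + ((f 1 + \<i> * f \<i>) / 2) * cis (of_int (-1) * t)" for t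
    by (simp add: lin[of "cis t"] complex_eq_iff field_simps)
  then show ?case by (simp only: trig_poly.intros)
next
  case (mult f g)
  then show ?case using trig_poly_mult by simp
next
  case (add f g)
  then show ?case using trig_poly.add by simp
qed (simp add: trig_poly_const)

lemma trig_poly_polynomial_function:
  assumes "polynomial_function p"
  shows "trig_poly (\<lambda>t. p (cis t))"
proof -
  have "real_polynomial_function (Re \<circ> p)" "real_polynomial_function (Im \<circ> p)"
    using assms bounded_linear_Re bounded_linear_Im by (auto simp: polynomial_function_def)
  then have "trig_poly (\<lambda>t. of_real (Re (p (cis t))) + \<i> * of_real (Im (p (cis t))))"
    using trig_poly_real_polynomial_function[of "Re \<circ> p"] trig_poly_real_polynomial_function[of "Im \<circ> p"]
    by (intro trig_poly.add trig_poly_mult trig_poly_const) simp_all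
  then show ?thesis by (simp flip: complex_eq)
qed

text \<open>The phase itself is discontinuous where the kernel vanishes with a change of sign;
  adding \<open>e\<close> to the denominator makes the quotient continuous at the price of an error
  of order \<open>e\<close> later. As a function of \<open>cis t\<close> it lives on a compact
  circle, where Stone-Weierstrass applies.\<close>

lemma trig_poly_approx_dirichlet:
  assumes "e > 0"
  obtains f where "trig_poly f" "\<And>t. cmod (f t - dirichlet d t / (cmod (dirichlet d t) + e)) < e"
proof -
  define p :: "complex \<Rightarrow> complex" where "p z = (\<Sum>k\<le>d. z ^ k)" for z
  have dirichlet: "dirichlet d t = p (cis t)" for t
    by (simp add: dirichlet_def p_def Complex.DeMoivre)
  have "complex_of_real (cmod (p z)) + e \<noteq> 0" for z
    using assms by (metis add_nonneg_pos norm_ge_zero of_real_add of_real_eq_0_iff less_irrefl)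
  then have "continuous_on (sphere 0 1) (\<lambda>z. p z / (cmod (p z) + e))"
    unfolding p_def by (intro continuous_intros) auto
  from Stone_Weierstrass_polynomial_function[OF compact_sphere this assms]
  obtain g where g: "polynomial_function g"
    "\<And>z. z \<in> sphere 0 1 \<Longrightarrow> norm (p z / (cmod (p z) + e) - g z) < e" by blast
  show ?thesis
  proof (rule that[OF trig_poly_polynomial_function[OF g(1)]])
    fix t show "cmod (g (cis t) - dirichlet d t / (cmod (dirichlet d t) + e)) < e"
      using g(2)[of "cis t"] by (simp add: dirichlet norm_minus_commute)
  qed
qed

section \<open>The upper bound\<close>

definition hom_span :: "('a \<Rightarrow> complex) \<Rightarrow> ('a \<Rightarrow> complex) \<Rightarrow> nat \<Rightarrow> ('a \<Rightarrow> complex) set" where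
  "hom_span u v d = {f. \<exists>c. f = (\<lambda>x. \<Sum>k\<le>d. c k * u x ^ k * v x ^ (d - k))}"

lemma hom_span_zero: "(\<lambda>x. 0) \<in> hom_span u v d"
  unfolding hom_span_def by (intro CollectI exI[of _ "\<lambda>_. 0"]) simp

lemma hom_span_add: "f \<in> hom_span u v d \<Longrightarrow> g \<in> hom_span u v d \<Longrightarrow> (\<lambda>x. f x + g x) \<in> hom_span u v d"
  unfolding hom_span_def
proof clarify
  fix c c'
  show "\<exists>c''. (\<lambda>x. (\<Sum>k\<le>d. c k * u x ^ k * v x ^ (d - k)) + (\<Sum>k\<le>d. c' k * u x ^ k * v x ^ (d - k))) =
      (\<lambda>x. \<Sum>k\<le>d. c'' k * u x ^ k * v x ^ (d - k))"
    by (rule exI[of _ "\<lambda>k. c k + c' k"]) (simp add: sum.distrib[symmetric] algebra_simps)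
qed

lemma hom_span_cmult: "f \<in> hom_span u v d \<Longrightarrow> (\<lambda>x. a * f x) \<in> hom_span u v d"
  unfolding hom_span_def
proof clarify
  fix c
  show "\<exists>c'. (\<lambda>x. a * (\<Sum>k\<le>d. c k * u x ^ k * v x ^ (d - k))) =
      (\<lambda>x. \<Sum>k\<le>d. c' k * u x ^ k * v x ^ (d - k))"
    by (rule exI[of _ "\<lambda>k. a * c k"]) (simp add: sum_distrib_left algebra_simps)
qed

lemma hom_span_sum:
  assumes "\<And>k. k \<in> A \<Longrightarrow> f k \<in> hom_span u v d"
  shows "(\<lambda>x. \<Sum>k\<in>A. f k x) \<in> hom_span u v d"
  using assms by (induction A rule: infinite_finite_induct) (simp_all add: hom_span_zero hom_span_add)

lemma hom_span_mult_left:
  assumes "f \<in> hom_span u v d"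
  shows "(\<lambda>x. u x * f x) \<in> hom_span u v (Suc d)"
proof -
  obtain c where f: "f = (\<lambda>x. \<Sum>k\<le>d. c k * u x ^ k * v x ^ (d - k))"
    using assms by (auto simp: hom_span_def)
  have "u x * f x = (\<Sum>k\<le>Suc d. (case k of 0 \<Rightarrow> 0 | Suc k \<Rightarrow> c k) * u x ^ k * v x ^ (Suc d - k))" for x
    unfolding f by (subst sum.atMost_Suc_shift) (simp add: sum_distrib_left algebra_simps)
  then show ?thesis
    unfolding hom_span_def
    by (intro CollectI exI[of _ "\<lambda>k. case k of 0 \<Rightarrow> 0 | Suc k \<Rightarrow> c k"]) (simp only:)
qed

lemma hom_span_mult_right:
  assumes "f \<in> hom_span u v d"
  shows "(\<lambda>x. v x * f x) \<in> hom_span u v (Suc d)"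
proof -
  obtain c where f: "f = (\<lambda>x. \<Sum>k\<le>d. c k * u x ^ k * v x ^ (d - k))"
    using assms by (auto simp: hom_span_def)
  have "v x * f x = (\<Sum>k\<le>Suc d. (if k \<le> d then c k else 0) * u x ^ k * v x ^ (Suc d - k))" for x
    by (simp add: f sum_distrib_left Suc_diff_le algebra_simps)
  then show ?thesis
    unfolding hom_span_def
    by (intro CollectI exI[of _ "\<lambda>k. if k \<le> d then c k else 0"]) (simp only:)
qed

lemma hom_span_mult_lin:
  assumes "f \<in> hom_span u v d"
  shows "(\<lambda>x. (\<alpha> * u x + \<beta> * v x) * f x) \<in> hom_span u v (Suc d)"
  using hom_span_add[OF hom_span_cmult[OF hom_span_mult_left[OF assms], of \<alpha>]
      hom_span_cmult[OF hom_span_mult_right[OF assms], of \<beta>]]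
  by (simp add: algebra_simps)

text \<open>Each monomial in the new variables is a product of linear factors in the old ones, and
  every such factor raises the degree of a form by exactly one. Keeping the two generators as
  parameters of \<open>hom_span\<close> lets the real coordinates and the pair of conjugate complex
  coordinates be treated alike.\<close>

lemma hom_span_change_basis:
  assumes u': "\<And>x. u' x = \<alpha> * u x + \<beta> * v x" and v': "\<And>x. v' x = \<gamma> * u x + \<delta> * v x"
  shows "hom_span u' v' d \<subseteq> hom_span u v d"
proof
  have one: "(\<lambda>x. 1) \<in> hom_span u v 0"
    unfolding hom_span_def by (intro CollectI exI[of _ "\<lambda>_. 1"]) simp
  have pow_v: "(\<lambda>x. v' x ^ j) \<in> hom_span u v j" for j
    by (induction j) (simp_all add: one v' hom_span_mult_lin)
  have pow: "(\<lambda>x. u' x ^ i * v' x ^ j) \<in> hom_span u v (i + j)" for i j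
  proof (induction i)
    case (Suc i)
    then show ?case using hom_span_mult_lin[OF Suc, of \<alpha> \<beta>] by (simp add: u' mult.assoc)
  qed (simp add: pow_v)
  fix f assume "f \<in> hom_span u' v' d"
  then obtain c where "f = (\<lambda>x. \<Sum>k\<le>d. c k * (u' x ^ k * v' x ^ (d - k)))"
    by (auto simp: hom_span_def mult.assoc)
  moreover have "(\<lambda>x. c k * (u' x ^ k * v' x ^ (d - k))) \<in> hom_span u v d" if "k \<le> d" for k
    using hom_span_cmult[OF pow[of k "d - k"], of "c k"] that by simp
  ultimately show "f \<in> hom_span u v d" by (simp only:) (intro hom_span_sum, simp)
qed

section \<open>Homogeneous polynomials on the circle as trigonometric sums\<close>

abbreviation pt :: "real \<Rightarrow> real ^ 2" where "pt \<theta> \<equiv> vector [cos \<theta>, sin \<theta>]"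

lemma pt_in_circle: "pt \<theta> \<in> circle"
  by (simp add: norm_vec_def L2_set_def sum_2)

lemma circle_eq_range_pt: "circle = range pt"
proof
  show "circle \<subseteq> range pt"
  proof
    fix x :: "real ^ 2" assume "x \<in> circle"
    then have "(x $ 1)\<^sup>2 + (x $ 2)\<^sup>2 = 1"
      by (simp add: norm_vec_def L2_set_def sum_2)
    then obtain \<theta> where "x $ 1 = cos \<theta>" "x $ 2 = sin \<theta>" using sincos_total_2pi by metis
    then have "x = pt \<theta>" by (simp add: vec_eq_iff forall_2)
    then show "x \<in> range pt" by blast
  qed
qed (use pt_in_circle in blast)

definition trig_sum :: "nat \<Rightarrow> (nat \<Rightarrow> complex) \<Rightarrow> real \<Rightarrow> complex" where
  "trig_sum d a t = (\<Sum>k\<le>d. a k * cis (real k * t))"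

text \<open>The factor \<open>cis (d t / 2)\<close> removes the negative frequencies, and halving \<open>t\<close> the parity constraint.\<close>
definition lift :: "nat \<Rightarrow> (real ^ 2 \<Rightarrow> complex) \<Rightarrow> real \<Rightarrow> complex" where
  "lift d p t = cis (real d * t / 2) * p (pt (t / 2))"

text \<open>In the coordinates \<open>z = x + \<i> y\<close> and its conjugate every monomial
  restricts to a single character of the circle. The coefficients below express \<open>x\<close> and
  \<open>y\<close> as real and imaginary part of \<open>z\<close>, and conversely.\<close>

lemma homogeneous_polys_eq:
  "homogeneous_polys d = hom_span (\<lambda>x. Complex (x $ 1) (x $ 2)) (\<lambda>x. Complex (x $ 1) (- x $ 2)) d"
proof -
  have "homogeneous_polys d = hom_span (\<lambda>x. complex_of_real (x $ 1)) (\<lambda>x. complex_of_real (x $ 2)) d"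
    by (simp add: homogeneous_polys_def hom_span_def)
  also have "\<dots> = hom_span (\<lambda>x. Complex (x $ 1) (x $ 2)) (\<lambda>x. Complex (x $ 1) (- x $ 2)) d"
  proof
    show "hom_span (\<lambda>x. complex_of_real (x $ 1)) (\<lambda>x. complex_of_real (x $ 2)) d \<subseteq>
        hom_span (\<lambda>x. Complex (x $ 1) (x $ 2)) (\<lambda>x. Complex (x $ 1) (- x $ 2)) d"
      by (rule hom_span_change_basis[where \<alpha> = "1 / 2" and \<beta> = "1 / 2" and \<gamma> = "- \<i> / 2" and \<delta> = "\<i> / 2"])
        (auto simp: complex_eq_iff)
    show "hom_span (\<lambda>x. Complex (x $ 1) (x $ 2)) (\<lambda>x. Complex (x $ 1) (- x $ 2)) d \<subseteq>
        hom_span (\<lambda>x. complex_of_real (x $ 1)) (\<lambda>x. complex_of_real (x $ 2)) d"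
      by (rule hom_span_change_basis[where \<alpha> = 1 and \<beta> = \<i> and \<gamma> = 1 and \<delta> = "- \<i>"])
        (auto simp: complex_eq_iff)
  qed
  finally show ?thesis .
qed

text \<open>At the angle \<open>t / 2\<close> the monomial with \<open>k\<close> factors
  \<open>z\<close> and \<open>d - k\<close> conjugate factors has phase
  \<open>k * t - d * t / 2\<close>; the factor in \<open>lift\<close> cancels the second
  term.\<close>

lemma lift_hom_span:
  "lift d (\<lambda>x. \<Sum>k\<le>d. a k * Complex (x $ 1) (x $ 2) ^ k * Complex (x $ 1) (- x $ 2) ^ (d - k)) = trig_sum d a"
proof
  fix t
  have "cis (real d * t / 2) * (a k * cis (t / 2) ^ k * cis (- (t / 2)) ^ (d - k)) = a k * cis (real k * t)"
    if "k \<le> d" for k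
  proof -
    have "real d * t / 2 + (real k * (t / 2) + real (d - k) * (- (t / 2))) = real k * t"
      using that by (simp add: of_nat_diff field_simps)
    then have "cis (real d * t / 2) * (cis (t / 2) ^ k * cis (- (t / 2)) ^ (d - k)) = cis (real k * t)"
      by (simp only: Complex.DeMoivre cis_mult)
    then show ?thesis by (simp add: mult_ac)
  qed
  moreover have "Complex (pt (t / 2) $ 1) (pt (t / 2) $ 2) = cis (t / 2)"
    "Complex (pt (t / 2) $ 1) (- pt (t / 2) $ 2) = cis (- (t / 2))"
    by (simp_all add: complex_eq_iff)
  ultimately show "lift d (\<lambda>x. \<Sum>k\<le>d. a k * Complex (x $ 1) (x $ 2) ^ k * Complex (x $ 1) (- x $ 2) ^ (d - k)) t
      = trig_sum d a t"
    unfolding lift_def trig_sum_def sum_distrib_left by (intro sum.cong) (simp_all only: atMost_iff)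
qed

lemma lift_restrict [simp]: "lift d (restrict p circle) = lift d p"
  using pt_in_circle by (simp add: lift_def fun_eq_iff)

lemma lift_circle_poly:
  assumes "p \<in> carrier (circle_polys d)"
  shows "\<exists>a. lift d p = trig_sum d a"
proof -
  obtain a where "p = restrict (\<lambda>x. \<Sum>k\<le>d. a k * Complex (x $ 1) (x $ 2) ^ k * Complex (x $ 1) (- x $ 2) ^ (d - k)) circle"
    using assms by (auto simp: circle_polys_def homogeneous_polys_eq hom_span_def)
  then have "lift d p = trig_sum d a" by (simp only: lift_restrict lift_hom_span)
  then show ?thesis by (intro exI[of _ a])
qed

lemma ex_circle_poly: "\<exists>p \<in> carrier (circle_polys d). lift d p = trig_sum d a"
proof
  let ?p = "\<lambda>x. \<Sum>k\<le>d. a k * Complex (x $ 1) (x $ 2) ^ k * Complex (x $ 1) (- x $ 2) ^ (d - k)"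
  show "lift d (restrict ?p circle) = trig_sum d a" by (simp only: lift_restrict lift_hom_span)
  show "restrict ?p circle \<in> carrier (circle_polys d)"
    by (auto simp: circle_polys_def homogeneous_polys_eq hom_span_def)
qed

lemma norm_lift: "cmod (lift d p t) = cmod (p (pt (t / 2)))"
  by (simp add: lift_def norm_mult)

lemma lift_inject:
  assumes "p \<in> carrier (circle_polys d)" "q \<in> carrier (circle_polys d)" "lift d p = lift d q"
  shows "p = q"
proof (rule extensionalityI[where A = circle])
  show "p \<in> extensional circle" "q \<in> extensional circle"
    using assms by (auto simp: circle_polys_def)
  fix x assume "x \<in> circle"
  then obtain \<theta> where "x = pt \<theta>" using circle_eq_range_pt by auto
  then show "p x = q x" using fun_cong[OF assms(3), of "2 * \<theta>"] by (simp add: lift_def)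
qed

lemma lift_add: "lift d (p \<oplus>\<^bsub>circle_polys d\<^esub> q) t = lift d p t + lift d q t"
  and lift_smult: "lift d (a \<odot>\<^bsub>circle_polys d\<^esub> p) t = a * lift d p t"
  using pt_in_circle by (simp_all add: lift_def circle_polys_def algebra_simps)

lemma circle_polys_add_closed:
  assumes "p \<in> carrier (circle_polys d)" "q \<in> carrier (circle_polys d)"
  shows "p \<oplus>\<^bsub>circle_polys d\<^esub> q \<in> carrier (circle_polys d)"
proof -
  obtain f g where "f \<in> homogeneous_polys d" "g \<in> homogeneous_polys d"
    "p = restrict f circle" "q = restrict g circle"
    using assms by (auto simp: circle_polys_def)
  then show ?thesis
    using hom_span_add[of f _ _ d g]
    by (auto simp: circle_polys_def homogeneous_polys_eq intro!: image_eqI[of _ _ "\<lambda>x. f x + g x"])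
qed

lemma circle_polys_smult_closed:
  assumes "p \<in> carrier (circle_polys d)"
  shows "a \<odot>\<^bsub>circle_polys d\<^esub> p \<in> carrier (circle_polys d)"
proof -
  obtain f where "f \<in> homogeneous_polys d" "p = restrict f circle"
    using assms by (auto simp: circle_polys_def)
  then show ?thesis
    using hom_span_cmult[of f _ _ d a]
    by (auto simp: circle_polys_def homogeneous_polys_eq intro!: image_eqI[of _ _ "\<lambda>x. a * f x"])
qed

lemma vnorm_circle_polys: "\<parallel>p\<parallel>\<^bsub>circle_polys d\<^esub> = (SUP t. cmod (lift d p t))"
proof -
  have "(\<lambda>x. cmod (p x)) ` circle = range (\<lambda>t. cmod (lift d p t))"
  proof -
    have "circle = range (\<lambda>t. pt (t / 2))"
    proof -
      have "pt \<theta> = pt ((2 * \<theta>) / 2)" for \<theta> by simp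
      then show ?thesis unfolding circle_eq_range_pt by blast
    qed
    then show ?thesis by (simp add: norm_lift image_image)
  qed
  then show ?thesis by (simp add: circle_polys_def)
qed

lemma norm_trig_sum_le: "cmod (trig_sum d a t) \<le> (\<Sum>k\<le>d. cmod (a k))"
  unfolding trig_sum_def by (rule sum_norm_le) (simp add: norm_mult)

lemma norm_lift_le:
  assumes "p \<in> carrier (circle_polys d)"
  shows "cmod (lift d p t) \<le> \<parallel>p\<parallel>\<^bsub>circle_polys d\<^esub>"
proof -
  obtain a where "lift d p = trig_sum d a" using lift_circle_poly[OF assms] by blast
  then show ?thesis
    unfolding vnorm_circle_polys
    by (intro cSUP_upper bdd_aboveI2[where M = "\<Sum>k\<le>d. cmod (a k)"]) (auto simp: norm_trig_sum_le)
qed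

lemma vnorm_circle_polys_le: "(\<And>t. cmod (lift d p t) \<le> B) \<Longrightarrow> \<parallel>p\<parallel>\<^bsub>circle_polys d\<^esub> \<le> B"
  unfolding vnorm_circle_polys by (rule cSUP_least) auto

text \<open>Discrete Fourier inversion: with more than \<open>d\<close> nodes no two of the
  frequencies 0 to \<open>d\<close> are aliased. This is why the sampled operator of the upper bound
  fixes the subspace.\<close>

lemma trig_sum_coeff:
  assumes "d < N" "k \<le> d"
  shows "(\<Sum>j<N. trig_sum d a (node N j) * cis (- (real k * node N j))) / N = a k"
proof -
  have "(\<Sum>j<N. trig_sum d a (node N j) * cis (- (real k * node N j))) =
      (\<Sum>j<N. \<Sum>l\<le>d. a l * cis (of_int (int l - int k) * node N j))"
    by (simp add: trig_sum_def sum_distrib_right mult.assoc cis_mult left_diff_distrib diff_divide_distrib)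
  also have "\<dots> = (\<Sum>l\<le>d. a l * (\<Sum>j<N. cis (of_int (int l - int k) * node N j)))"
    by (subst sum.swap) (simp add: sum_distrib_left)
  also have "\<dots> = (\<Sum>l\<le>d. if l = k then a k * of_nat N else 0)"
  proof (rule sum.cong)
    fix l assume "l \<in> {..d}"
    then have "\<bar>int l - int k\<bar> < int N" using assms by auto
    from sum_cis_nodes[OF this]
    show "a l * (\<Sum>j<N. cis (of_int (int l - int k) * node N j)) = (if l = k then a k * of_nat N else 0)"
      by simp
  qed simp
  also have "\<dots> = a k * of_nat N" using assms by simp
  finally show ?thesis using assms by simp
qed

text \<open>Evaluation of the lift at a point is a functional of norm at most 1 on the embedded
  copy. Its extensions to \<open>Y\<close> provide samples of every vector, and the polynomial built
  from \<open>N\<close> samples defines a projection of norm at most the Lebesgue constant plus an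
  error of order \<open>1 / N\<close>.\<close>

lemma rel_proj_const_le:
  fixes Y :: "'y normed_module"
  assumes "complex_normed_space Y" and I: "I \<in> isometric_embeddings (circle_polys d) Y"
  shows "rel_proj_const (I ` carrier (circle_polys d)) Y \<le> ereal (lebesgue_const d)"
proof -
  interpret complex_normed_space Y by fact
  let ?X = "circle_polys d"
  define M where "M = I ` carrier ?X"
  have I_closed: "\<And>p. p \<in> carrier ?X \<Longrightarrow> I p \<in> carrier Y"
    and I_add: "\<And>p q. p \<in> carrier ?X \<Longrightarrow> q \<in> carrier ?X \<Longrightarrow> I (p \<oplus>\<^bsub>?X\<^esub> q) = I p \<oplus>\<^bsub>Y\<^esub> I q"
    and I_smult: "\<And>a p. p \<in> carrier ?X \<Longrightarrow> I (a \<odot>\<^bsub>?X\<^esub> p) = a \<odot>\<^bsub>Y\<^esub> I p"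
    and I_norm: "\<And>p. p \<in> carrier ?X \<Longrightarrow> \<parallel>I p\<parallel>\<^bsub>Y\<^esub> = \<parallel>p\<parallel>\<^bsub>?X\<^esub>"
    using I by (auto simp: isometric_embeddings_def linear_maps_def)
  have inj: "inj_on I (carrier ?X)"
  proof (rule inj_onI)
    fix p q assume p: "p \<in> carrier ?X" and q: "q \<in> carrier ?X" and eq: "I p = I q"
    \<comment> \<open>The difference is composed of addition and scaling, the operations that
      \<open>I\<close> is known to respect.\<close>
    define r where "r = p \<oplus>\<^bsub>?X\<^esub> ((-1) \<odot>\<^bsub>?X\<^esub> q)"
    have r: "r \<in> carrier ?X"
      unfolding r_def by (intro circle_polys_add_closed circle_polys_smult_closed p q)
    have "I r = I q \<oplus>\<^bsub>Y\<^esub> \<ominus>\<^bsub>Y\<^esub> I q"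
      using p q eq by (simp add: r_def I_add I_smult circle_polys_smult_closed smult_minus_1 I_closed)
    then have "\<parallel>r\<parallel>\<^bsub>?X\<^esub> = 0" using I_norm[OF r] I_closed[OF q] by (simp add: r_neg)
    then have "lift d r t = 0" for t using norm_lift_le[OF r, of t] by simp
    then have "lift d p t = lift d q t" for t
      using lift_add[of d p "(-1) \<odot>\<^bsub>?X\<^esub> q" t] by (simp add: r_def lift_smult)
    then show "p = q" using lift_inject[OF p q] by blast
  qed
  have MC: "M \<subseteq> carrier Y" using I_closed by (auto simp: M_def)
  have M_add: "x \<oplus>\<^bsub>Y\<^esub> y \<in> M" if "x \<in> M" "y \<in> M" for x y
    using that by (auto simp: M_def I_add[symmetric] intro!: imageI circle_polys_add_closed)
  have M_smult: "a \<odot>\<^bsub>Y\<^esub> x \<in> M" if "x \<in> M" for a x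
    using that by (auto simp: M_def I_smult[symmetric] intro!: imageI circle_polys_smult_closed)
  define J where "J = inv_into (carrier ?X) I"
  have JI [simp]: "J (I p) = p" if "p \<in> carrier ?X" for p
    using that inj by (simp add: J_def)
  have ext: "\<forall>t. \<exists>F. (\<forall>x\<in>carrier Y. \<forall>y\<in>carrier Y. F (x \<oplus>\<^bsub>Y\<^esub> y) = F x + F y) \<and>
      (\<forall>a. \<forall>x\<in>carrier Y. F (a \<odot>\<^bsub>Y\<^esub> x) = a * F x) \<and>
      (\<forall>x\<in>carrier Y. cmod (F x) \<le> \<parallel>x\<parallel>\<^bsub>Y\<^esub>) \<and>
      (\<forall>p\<in>carrier ?X. F (I p) = lift d p t)"
  proof
    fix t
    let ?f = "\<lambda>x. lift d (J x) t"
    have "M \<noteq> {}" using ex_circle_poly[of d] by (auto simp: M_def)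
    have f_add: "?f (x \<oplus>\<^bsub>Y\<^esub> y) = ?f x + ?f y" if "x \<in> M" "y \<in> M" for x y
      using that by (auto simp: M_def I_add[symmetric] circle_polys_add_closed lift_add)
    have f_smult: "?f (a \<odot>\<^bsub>Y\<^esub> x) = a * ?f x" if "x \<in> M" for a x
      using that by (auto simp: M_def I_smult[symmetric] circle_polys_smult_closed lift_smult)
    have f_norm: "cmod (?f x) \<le> \<parallel>x\<parallel>\<^bsub>Y\<^esub>" if "x \<in> M" for x
      using that norm_lift_le by (auto simp: M_def I_norm)
    obtain F where F:
      "\<And>x y. x \<in> carrier Y \<Longrightarrow> y \<in> carrier Y \<Longrightarrow> F (x \<oplus>\<^bsub>Y\<^esub> y) = F x + F y"
      "\<And>a x. x \<in> carrier Y \<Longrightarrow> F (a \<odot>\<^bsub>Y\<^esub> x) = a * F x"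
      "\<And>x. x \<in> carrier Y \<Longrightarrow> cmod (F x) \<le> \<parallel>x\<parallel>\<^bsub>Y\<^esub>"
      "\<And>x. x \<in> M \<Longrightarrow> F x = ?f x"
      by (rule hahn_banach[of M ?f, OF MC \<open>M \<noteq> {}\<close> M_add M_smult f_add f_smult f_norm]) blast+
    have "F (I p) = lift d p t" if "p \<in> carrier ?X" for p
      using F(4)[of "I p"] that by (simp add: M_def)
    with F show "\<exists>F. (\<forall>x\<in>carrier Y. \<forall>y\<in>carrier Y. F (x \<oplus>\<^bsub>Y\<^esub> y) = F x + F y) \<and>
      (\<forall>a. \<forall>x\<in>carrier Y. F (a \<odot>\<^bsub>Y\<^esub> x) = a * F x) \<and>
      (\<forall>x\<in>carrier Y. cmod (F x) \<le> \<parallel>x\<parallel>\<^bsub>Y\<^esub>) \<and>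
      (\<forall>p\<in>carrier ?X. F (I p) = lift d p t)"
      by (intro exI[of _ F]) blast
  qed
  obtain \<Phi> where \<Phi>: "\<forall>t. (\<forall>x\<in>carrier Y. \<forall>y\<in>carrier Y. \<Phi> t (x \<oplus>\<^bsub>Y\<^esub> y) = \<Phi> t x + \<Phi> t y) \<and>
      (\<forall>a. \<forall>x\<in>carrier Y. \<Phi> t (a \<odot>\<^bsub>Y\<^esub> x) = a * \<Phi> t x) \<and>
      (\<forall>x\<in>carrier Y. cmod (\<Phi> t x) \<le> \<parallel>x\<parallel>\<^bsub>Y\<^esub>) \<and>
      (\<forall>p\<in>carrier ?X. \<Phi> t (I p) = lift d p t)"
    by (rule exE[OF choice[OF ext]])
  have \<Phi>_add: "\<Phi> t (x \<oplus>\<^bsub>Y\<^esub> y) = \<Phi> t x + \<Phi> t y" if "x \<in> carrier Y" "y \<in> carrier Y" for t x y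
    using \<Phi> that by blast
  have \<Phi>_smult: "\<Phi> t (a \<odot>\<^bsub>Y\<^esub> x) = a * \<Phi> t x" if "x \<in> carrier Y" for t a x
    using \<Phi> that by blast
  have \<Phi>_norm: "cmod (\<Phi> t x) \<le> \<parallel>x\<parallel>\<^bsub>Y\<^esub>" if "x \<in> carrier Y" for t x
    using \<Phi> that by blast
  have \<Phi>_I: "\<Phi> t (I p) = lift d p t" if "p \<in> carrier ?X" for t p
    using \<Phi> that by blast
  have "\<forall>a. \<exists>p. p \<in> carrier ?X \<and> lift d p = trig_sum d a" using ex_circle_poly[of d] by blast
  then obtain el where el0: "\<forall>a. el a \<in> carrier ?X \<and> lift d (el a) = trig_sum d a"
    by (rule exE[OF choice])
  have el: "el a \<in> carrier ?X" "lift d (el a) = trig_sum d a" for a using el0 by blast+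
  have bound: "rel_proj_const M Y \<le> ereal (lebesgue_const d + 2 * pi * (real d * (real d + 1)) / N)" if N: "d < N" for N
  proof -
    \<comment> \<open>Discrete Fourier coefficients of the samples of \<open>y\<close>, cut off to
      the frequencies 0 to \<open>d\<close>; exchanging the sums turns this into convolution with
      the kernel.\<close>
    define R where "R y = el (\<lambda>k. (\<Sum>j<N. \<Phi> (node N j) y * cis (- (real k * node N j))) / N)" for y
    define P where "P y = I (R y)" for y
    have R: "R y \<in> carrier ?X" for y by (simp add: R_def el)
    have lift_R: "lift d (R y) t = (\<Sum>j<N. \<Phi> (node N j) y * dirichlet d (t - node N j)) / N" for y t
    proof -
      have "lift d (R y) t = (\<Sum>k\<le>d. (\<Sum>j<N. \<Phi> (node N j) y * cis (real k * (t - node N j)) / N))"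
        by (simp add: R_def el trig_sum_def sum_distrib_right sum_divide_distrib mult.assoc cis_mult
            right_diff_distrib)
      also have "\<dots> = (\<Sum>j<N. \<Phi> (node N j) y * dirichlet d (t - node N j)) / N"
        by (subst sum.swap) (simp add: dirichlet_def sum_distrib_left sum_divide_distrib)
      finally show ?thesis .
    qed
    have P_M: "P y \<in> M" for y using R by (simp add: P_def M_def)
    have P_add: "P (x \<oplus>\<^bsub>Y\<^esub> y) = P x \<oplus>\<^bsub>Y\<^esub> P y" if "x \<in> carrier Y" "y \<in> carrier Y" for x y
    proof -
      have "R (x \<oplus>\<^bsub>Y\<^esub> y) = R x \<oplus>\<^bsub>?X\<^esub> R y"
        by (intro lift_inject[of _ d] ext R circle_polys_add_closed)
          (simp add: fun_eq_iff lift_add lift_R \<Phi>_add that sum.distrib distrib_right add_divide_distrib)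
      then show ?thesis using R by (simp add: P_def I_add)
    qed
    have P_smult: "P (a \<odot>\<^bsub>Y\<^esub> x) = a \<odot>\<^bsub>Y\<^esub> P x" if "x \<in> carrier Y" for a x
    proof -
      have "R (a \<odot>\<^bsub>Y\<^esub> x) = a \<odot>\<^bsub>?X\<^esub> R x"
        by (intro lift_inject[of _ d] ext R circle_polys_smult_closed)
          (simp add: fun_eq_iff lift_smult lift_R \<Phi>_smult that sum_distrib_left mult.assoc)
      then show ?thesis using R by (simp add: P_def I_smult)
    qed
    have P_id: "P x = x" if x: "x \<in> M" for x
    proof -
      obtain p where p: "p \<in> carrier ?X" "x = I p" using x by (auto simp: M_def)
      obtain a where a: "lift d p = trig_sum d a" using lift_circle_poly[OF p(1)] by blast
      have "(\<Sum>j<N. \<Phi> (node N j) x * cis (- (real k * node N j))) / N = a k" if "k \<le> d" for k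
        by (simp only: p(2) \<Phi>_I[OF p(1)] a trig_sum_coeff[OF N that])
      then have "lift d (R x) = lift d p"
        by (simp add: R_def el a trig_sum_def fun_eq_iff del: times_divide_eq_right)
      then have "R x = p" using R p by (intro lift_inject[of _ d]) auto
      then show ?thesis by (simp add: P_def p)
    qed
    have P_norm: "\<parallel>P y\<parallel>\<^bsub>Y\<^esub> \<le> (lebesgue_const d + 2 * pi * (real d * (real d + 1)) / N) * \<parallel>y\<parallel>\<^bsub>Y\<^esub>" if y: "y \<in> carrier Y" for y
    proof -
      have "cmod (lift d (R y) t) \<le> (lebesgue_const d + 2 * pi * (real d * (real d + 1)) / N) * \<parallel>y\<parallel>\<^bsub>Y\<^esub>" for t
      proof -
        \<comment> \<open>The modulus of the kernel is even, so the argument can be brought to the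
          form \<open>s + node N j\<close> with \<open>s = - t\<close>, to which the uniform Riemann
          sum estimate applies.\<close>
        have "cmod (\<Sum>j<N. \<Phi> (node N j) y * dirichlet d (t - node N j))
            \<le> (\<Sum>j<N. \<parallel>y\<parallel>\<^bsub>Y\<^esub> * cmod (dirichlet d (- t + node N j)))"
        proof (rule sum_norm_le)
          fix j
          have "cmod (\<Phi> (node N j) y) * cmod (dirichlet d (- (- t + node N j)))
              \<le> \<parallel>y\<parallel>\<^bsub>Y\<^esub> * cmod (dirichlet d (- t + node N j))"
            unfolding norm_dirichlet_uminus using \<Phi>_norm[OF y] by (intro mult_right_mono) auto
          then show "cmod (\<Phi> (node N j) y * dirichlet d (t - node N j)) \<le> \<parallel>y\<parallel>\<^bsub>Y\<^esub> * cmod (dirichlet d (- t + node N j))"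
            by (simp add: norm_mult)
        qed
        then have "cmod (lift d (R y) t) \<le> \<parallel>y\<parallel>\<^bsub>Y\<^esub> * ((\<Sum>j<N. cmod (dirichlet d (- t + node N j))) / N)"
          unfolding lift_R using N by (simp add: norm_divide divide_right_mono sum_distrib_left)
        also have "\<dots> \<le> \<parallel>y\<parallel>\<^bsub>Y\<^esub> * (lebesgue_const d + 2 * pi * (real d * (real d + 1)) / N)"
          using mean_norm_dirichlet_nodes[of N d "- t"] N vnorm_nonneg[OF y]
          by (intro mult_left_mono) auto
        finally show ?thesis by (simp only: mult.commute)
      qed
      then show ?thesis using R by (simp add: P_def I_norm vnorm_circle_polys_le)
    qed
    let ?YM = "Y\<lparr>carrier := M\<rparr>"
    have "P \<in> bounded_linear_maps Y ?YM"
      unfolding bounded_linear_maps_def linear_maps_def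
      using P_M P_add P_smult
      by (auto intro!: exI[of _ "lebesgue_const d + 2 * pi * (real d * (real d + 1)) / N"] simp: P_norm)
    then have "rel_proj_const M Y \<le> op_norm Y ?YM P"
      unfolding rel_proj_const_def using P_id by (intro Inf_lower) auto
    also have "\<dots> \<le> ereal (lebesgue_const d + 2 * pi * (real d * (real d + 1)) / N)"
      unfolding op_norm_def
    proof (rule SUP_least)
      fix y assume y: "y \<in> {y \<in> carrier Y. \<parallel>y\<parallel>\<^bsub>Y\<^esub> \<le> 1}"
      have "0 \<le> lebesgue_const d" unfolding lebesgue_const_def by (simp add: integral_nonneg integrable_norm_dirichlet)
      then have "(lebesgue_const d + 2 * pi * (real d * (real d + 1)) / N) * \<parallel>y\<parallel>\<^bsub>Y\<^esub>
          \<le> (lebesgue_const d + 2 * pi * (real d * (real d + 1)) / N) * 1"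
        using y by (intro mult_left_mono) auto
      then show "ereal (\<parallel>P y\<parallel>\<^bsub>?YM\<^esub>) \<le> ereal (lebesgue_const d + 2 * pi * (real d * (real d + 1)) / N)"
        using P_norm[of y] y by simp
    qed
    finally show ?thesis .
  qed
  \<comment> \<open>The left side is an infimum independent of \<open>N\<close>, so the sampling
    error can be made arbitrarily small.\<close>
  have "rel_proj_const M Y \<le> ereal (lebesgue_const d) + ereal e" if e: "e > 0" for e
  proof -
    obtain n :: nat where n: "2 * pi * (real d * (real d + 1)) / e < real n"
      using reals_Archimedean2 by blast
    obtain N where N: "n \<le> N" "d < N"
      by (rule that[of "n + Suc d"]) auto
    have "2 * pi * (real d * (real d + 1)) / e < real N" using n N by linarith
    then have "2 * pi * (real d * (real d + 1)) / N \<le> e"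
      using e N by (simp add: field_simps)
    then have "ereal (lebesgue_const d + 2 * pi * (real d * (real d + 1)) / N) \<le> ereal (lebesgue_const d) + ereal e"
      by simp
    then show ?thesis using bound[OF N(2)] by (rule order_trans[rotated])
  qed
  then show ?thesis unfolding M_def by (rule ereal_le_epsilon2[rotated]) 
qed

section \<open>The lower bound\<close>

definition smul :: "complex \<Rightarrow> (real \<Rightarrow>\<^sub>C complex) \<Rightarrow> real \<Rightarrow>\<^sub>C complex" where
  "smul a f = Bcontfun (\<lambda>x. a * apply_bcontfun f x)"

definition shift :: "real \<Rightarrow> (real \<Rightarrow>\<^sub>C complex) \<Rightarrow> real \<Rightarrow>\<^sub>C complex" where
  "shift s f = Bcontfun (\<lambda>x. apply_bcontfun f (x + s))"

definition character :: "int \<Rightarrow> real \<Rightarrow>\<^sub>C complex" where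
  "character k = Bcontfun (\<lambda>t. cis (of_int k * t))"

lemma smul_apply [simp]: "apply_bcontfun (smul a f) x = a * apply_bcontfun f x"
proof -
  have "(\<lambda>x. a * apply_bcontfun f x) \<in> bcontfun"
    by (rule bcontfun_normI[where b = "cmod a * norm f"])
      (auto intro!: continuous_intros mult_left_mono norm_bounded simp: norm_mult)
  then show ?thesis by (simp add: smul_def Bcontfun_inverse)
qed

lemma shift_apply [simp]: "apply_bcontfun (shift s f) x = apply_bcontfun f (x + s)"
proof -
  have "(\<lambda>x. apply_bcontfun f (x + s)) \<in> bcontfun"
    by (rule bcontfun_normI[where b = "norm f"])
      (auto intro!: continuous_on_compose2[OF continuous_on_apply_bcontfun[of UNIV]]
        continuous_intros norm_bounded)
  then show ?thesis by (simp add: shift_def Bcontfun_inverse)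
qed

lemma character_apply [simp]: "apply_bcontfun (character k) t = cis (of_int k * t)"
proof -
  have "(\<lambda>t. cis (of_int k * t)) \<in> bcontfun"
    by (rule bcontfun_normI[where b = 1]) (auto intro!: continuous_intros)
  then show ?thesis by (simp add: character_def Bcontfun_inverse)
qed

lemma norm_smul: "norm (smul a f) = cmod a * norm f"
proof (rule antisym)
  show le: "norm (smul a f) \<le> cmod a * norm f" for a f
    by (rule norm_bound) (simp add: norm_mult mult_left_mono norm_bounded)
  show "cmod a * norm f \<le> norm (smul a f)"
  proof (cases "a = 0")
    case False
    then have "f = smul (1 / a) (smul a f)" by (intro bcontfun_eqI) simp
    then have "norm f \<le> cmod (1 / a) * norm (smul a f)" using le[of "1 / a" "smul a f"] by simp
    then show ?thesis using False by (simp add: norm_divide field_simps)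
  qed simp
qed

lemma norm_shift_le: "norm (shift s f) \<le> norm f"
  by (rule norm_bound) (simp add: norm_bounded)

lemma trig_poly_bcontfun: "trig_poly f \<Longrightarrow> f \<in> bcontfun"
proof (induction rule: trig_poly.induct)
  case (monomial c k)
  show ?case
    by (rule bcontfun_normI[where b = "cmod c"]) (auto intro!: continuous_intros simp: norm_mult)
qed (rule plus_cont)

section \<open>Averaging a projection over rotations\<close>

lemma sum_cis_mult_nodes:
  assumes "\<bar>k\<bar> + int d < int N"
  shows "(\<Sum>j<N. cis (of_int k * node N j) * (\<Sum>l\<le>d. b l * cis (- (real l * node N j)))) =
      (\<Sum>l\<le>d. b l * (if k = int l then of_nat N else 0))"
proof -
  have "(\<Sum>j<N. cis (of_int k * node N j) * (\<Sum>l\<le>d. b l * cis (- (real l * node N j)))) =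
      (\<Sum>j<N. \<Sum>l\<le>d. b l * (cis (of_int k * node N j) * cis (- (real l * node N j))))"
    by (simp add: sum_distrib_left mult_ac)
  also have "\<dots> = (\<Sum>j<N. \<Sum>l\<le>d. b l * cis (of_int (k - int l) * node N j))"
    by (simp add: cis_mult left_diff_distrib diff_divide_distrib)
  also have "\<dots> = (\<Sum>l\<le>d. b l * (\<Sum>j<N. cis (of_int (k - int l) * node N j)))"
    by (subst sum.swap) (simp only: sum_distrib_left)
  also have "\<dots> = (\<Sum>l\<le>d. b l * (if k = int l then of_nat N else 0))"
  proof (rule sum.cong)
    fix l assume "l \<in> {..d}"
    then have "\<bar>k - int l\<bar> < int N" using assms by auto
    from sum_cis_nodes[OF this]
    show "b l * (\<Sum>j<N. cis (of_int (k - int l) * node N j)) = b l * (if k = int l then of_nat N else 0)"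
      by simp
  qed simp
  finally show ?thesis .
qed

text \<open>Up to the factor \<open>N\<close>, the left side is the average of the conjugates of
  \<open>Q\<close> by translations, evaluated at 0. Translating character \<open>k\<close> only
  multiplies it by a scalar, so the average extracts the coefficient of frequency \<open>k\<close>
  from \<open>Q (character k)\<close>: it is 1 for frequencies 0 to \<open>d\<close>, which
  \<open>Q\<close> fixes, and 0 for all others, which do not occur in the range. Additivity then
  reaches all trigonometric polynomials, with a threshold for \<open>N\<close> that depends on the
  polynomial.\<close>

lemma sum_rotations:
  fixes Q :: "(real \<Rightarrow>\<^sub>C complex) \<Rightarrow> real \<Rightarrow>\<^sub>C complex"
  assumes add: "\<And>f g. Q (f + g) = Q f + Q g" and smul: "\<And>a f. Q (smul a f) = smul a (Q f)"
    and range: "\<And>f. \<exists>a. apply_bcontfun (Q f) = trig_sum d a"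
    and fix_character: "\<And>k. k \<le> d \<Longrightarrow> Q (character (int k)) = character (int k)"
    and f: "trig_poly f"
  shows "\<forall>\<^sub>F N in sequentially.
      (\<Sum>j<N. apply_bcontfun (Q (shift (node N j) (Bcontfun f))) (- node N j)) =
      (\<Sum>j<N. f (node N j) * cnj (dirichlet d (node N j)))"
  using f
proof (induction rule: trig_poly.induct)
  case (monomial c k)
  have mono: "(\<lambda>t. c * cis (of_int k * t)) \<in> bcontfun"
    by (rule trig_poly_bcontfun[OF trig_poly.monomial])
  have shift: "shift s (Bcontfun (\<lambda>t. c * cis (of_int k * t))) = smul (c * cis (of_int k * s)) (character k)" for s
    by (rule bcontfun_eqI, unfold shift_apply smul_apply character_apply Bcontfun_inverse[OF mono])
      (simp add: distrib_left cis_mult[symmetric])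
  obtain a where a: "apply_bcontfun (Q (character k)) = trig_sum d a" using range by blast
  show ?case
    using eventually_gt_at_top[of "nat \<bar>k\<bar> + d"]
  proof eventually_elim
    case (elim N)
    then have N: "\<bar>k\<bar> + int d < int N" by linarith
    have "(\<Sum>j<N. apply_bcontfun (Q (shift (node N j) (Bcontfun (\<lambda>t. c * cis (of_int k * t))))) (- node N j)) =
        c * (\<Sum>j<N. cis (of_int k * node N j) * apply_bcontfun (Q (character k)) (- node N j))"
      by (simp only: shift smul smul_apply sum_distrib_left mult.assoc)
    also have "\<dots> = c * (\<Sum>l\<le>d. if k = int l then of_nat N else 0)"
    proof (cases "0 \<le> k \<and> k \<le> int d")
      case True
      then obtain k' where k': "k = int k'" "k' \<le> d" by (metis nat_0_le nat_le_iff of_nat_le_iff)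
      then have "Q (character k) = character k" using fix_character by simp
      then have "(\<Sum>j<N. cis (of_int k * node N j) * apply_bcontfun (Q (character k)) (- node N j)) = of_nat N"
        by (simp add: cis_mult)
      moreover have "(\<Sum>l\<le>d. if k = int l then of_nat N else 0) = (of_nat N :: complex)"
        using k' by simp
      ultimately show ?thesis by simp
    next
      case False
      have "(\<Sum>j<N. cis (of_int k * node N j) * apply_bcontfun (Q (character k)) (- node N j)) =
          (\<Sum>j<N. cis (of_int k * node N j) * (\<Sum>l\<le>d. a l * cis (- (real l * node N j))))"
        by (simp add: a trig_sum_def)
      also have "\<dots> = (\<Sum>l\<le>d. a l * (if k = int l then of_nat N else 0))"
        by (rule sum_cis_mult_nodes[OF N])
      also have "\<dots> = 0" using False by (intro sum.neutral) auto
      also have "0 = (\<Sum>l\<le>d. if k = int l then of_nat N else (0 :: complex))"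
        using False by (intro sum.neutral[symmetric]) auto
      finally show ?thesis by simp
    qed
    \<comment> \<open>The same orthogonality read backwards, with all coefficients equal to 1,
      reassembles the conjugated kernel.\<close>
    also have "(\<Sum>l\<le>d. if k = int l then of_nat N else 0) =
        (\<Sum>j<N. cis (of_int k * node N j) * (\<Sum>l\<le>d. 1 * cis (- (real l * node N j))))"
      by (subst sum_cis_mult_nodes[OF N]) simp
    also have "c * \<dots> = (\<Sum>j<N. c * cis (of_int k * node N j) * cnj (dirichlet d (node N j)))"
      by (simp add: dirichlet_def cis_cnj sum_distrib_left mult.assoc)
    finally show ?case .
  qed
next
  case (add f g)
  have shift: "shift s (Bcontfun (\<lambda>t. f t + g t)) = shift s (Bcontfun f) + shift s (Bcontfun g)" for s
    using add.hyps
    by (intro bcontfun_eqI) (simp add: Bcontfun_inverse trig_poly_bcontfun plus_cont)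
  from add.IH show ?case
    by eventually_elim (simp add: shift assms(1) sum.distrib distrib_right)
qed

text \<open>For a test function close to the phase of the kernel, the right side of
  \<open>sum_rotations\<close> is nearly the sum of the moduli of the kernel, while every summand on
  the left is at most about \<open>B\<close>. Dividing by \<open>N\<close> and letting
  \<open>e\<close> tend to 0 gives the claim.\<close>

lemma lebesgue_const_le_norm_projection:
  fixes Q :: "(real \<Rightarrow>\<^sub>C complex) \<Rightarrow> real \<Rightarrow>\<^sub>C complex"
  assumes add: "\<And>f g. Q (f + g) = Q f + Q g" and smul: "\<And>a f. Q (smul a f) = smul a (Q f)"
    and range: "\<And>f. \<exists>a. apply_bcontfun (Q f) = trig_sum d a"
    and fix_character: "\<And>k. k \<le> d \<Longrightarrow> Q (character (int k)) = character (int k)"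
    and bound: "\<And>f. norm f \<le> 1 \<Longrightarrow> norm (Q f) \<le> B"
  shows "lebesgue_const d \<le> B"
proof -
  have key: "(1 - e) * (lebesgue_const d - e) - e \<le> B * (1 + e)" if e: "0 < e" "e < 1" for e
  proof -
    obtain f where f: "trig_poly f" "\<And>t. cmod (f t - dirichlet d t / (cmod (dirichlet d t) + e)) < e"
      using trig_poly_approx_dirichlet[OF e(1)] by blast
    define F where "F = Bcontfun f"
    have F: "apply_bcontfun F = f" by (simp add: F_def Bcontfun_inverse trig_poly_bcontfun[OF f(1)])
    have "norm F \<le> 1 + e"
    proof (rule norm_bound)
      fix t
      have "cmod (dirichlet d t / (cmod (dirichlet d t) + e)) = cmod (dirichlet d t) / (cmod (dirichlet d t) + e)"
        using e by (simp add: norm_divide flip: of_real_add)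
      also have "\<dots> \<le> 1" using e by (simp add: divide_le_eq_1 add_nonneg_pos)
      finally show "norm (apply_bcontfun F t) \<le> 1 + e"
        using f(2)[of t] norm_triangle_sub[of "f t" "dirichlet d t / (cmod (dirichlet d t) + e)"]
        by (simp add: F)
    qed
    then have shift_le: "norm (shift s F) \<le> 1 + e" for s
      using norm_shift_le[of s F] by simp
    have Q_le: "norm (Q (shift s F)) \<le> B * (1 + e)" for s
    proof -
      \<comment> \<open>The hypothesis speaks of the unit ball only, while the test function may
        exceed norm 1 by \<open>e\<close>.\<close>
      define G where "G = smul (1 / complex_of_real (1 + e)) (shift s F)"
      have "norm G = norm (shift s F) / (1 + e)"
        unfolding G_def norm_smul using e by (simp add: norm_divide del: of_real_add)
      then have "norm (Q G) \<le> B" using shift_le[of s] e by (intro bound) (simp add: divide_le_eq)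
      moreover have "norm (Q G) = norm (Q (shift s F)) / (1 + e)"
        unfolding G_def smul norm_smul using e by (simp add: norm_divide del: of_real_add)
      ultimately show ?thesis using e by (simp add: divide_le_eq)
    qed
    obtain n :: nat where n: "2 * pi * (real d * (real d + 1)) / e < real n"
      using reals_Archimedean2 by blast
    \<comment> \<open>With \<open>f\<close> fixed, \<open>N\<close> is taken large for two reasons
      at once: the averaging identity must hold for \<open>f\<close>, and the Riemann sum must be
      within \<open>e\<close> of the Lebesgue constant.\<close>
    have "\<forall>\<^sub>F N in sequentially. N > n \<and>
        (\<Sum>j<N. apply_bcontfun (Q (shift (node N j) F)) (- node N j)) =
        (\<Sum>j<N. f (node N j) * cnj (dirichlet d (node N j)))"
      unfolding F_def
      by (intro eventually_conj eventually_gt_at_top sum_rotations add smul range fix_character f(1))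
    then obtain N where N: "N > n" and eq:
      "(\<Sum>j<N. apply_bcontfun (Q (shift (node N j) F)) (- node N j)) =
        (\<Sum>j<N. f (node N j) * cnj (dirichlet d (node N j)))"
      by (metis (mono_tags, lifting) eventually_sequentially order_refl)
    define R where "R = (\<Sum>j<N. cmod (dirichlet d (node N j))) / N"
    have "2 * pi * (real d * (real d + 1)) / e < real N" using n N by linarith
    then have "2 * pi * (real d * (real d + 1)) / N \<le> e" using e N by (simp add: field_simps)
    then have R: "lebesgue_const d - e \<le> R"
      using mean_norm_dirichlet_nodes[of N d 0] N by (simp add: R_def)
    have "(1 - e) * cmod (dirichlet d t) - e \<le> Re (f t * cnj (dirichlet d t))" for t
    proof -
      define x where "x = cmod (dirichlet d t)"
      define r where "r = f t - dirichlet d t / (x + e)"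
      have x: "x \<ge> 0" by (simp add: x_def)
      have r: "cmod r \<le> e" using f(2)[of t] by (simp add: r_def x_def)
      have "f t * cnj (dirichlet d t) = dirichlet d t * cnj (dirichlet d t) / (x + e) + r * cnj (dirichlet d t)"
        by (simp add: r_def algebra_simps)
      also have "dirichlet d t * cnj (dirichlet d t) / (x + e) = complex_of_real (x\<^sup>2 / (x + e))"
        by (simp only: x_def complex_norm_square of_real_divide of_real_add)
      finally have "Re (f t * cnj (dirichlet d t)) = x\<^sup>2 / (x + e) + Re (r * cnj (dirichlet d t))" by simp
      moreover have "cmod (r * cnj (dirichlet d t)) \<le> e * x"
        using r x by (simp add: norm_mult x_def mult_right_mono)
      then have "- (e * x) \<le> Re (r * cnj (dirichlet d t))"
        using abs_Re_le_cmod[of "r * cnj (dirichlet d t)"] by linarith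
      \<comment> \<open>This is \<open>(x - e) * (x + e) \<le> x\<^sup>2\<close>, the cost of
        regularizing the phase.\<close>
      moreover have "x - e \<le> x\<^sup>2 / (x + e)"
        using x e by (simp add: le_divide_eq add_nonneg_pos power2_eq_square algebra_simps)
      ultimately show ?thesis by (simp add: x_def algebra_simps)
    qed
    then have "(\<Sum>j<N. (1 - e) * cmod (dirichlet d (node N j)) - e) \<le> (\<Sum>j<N. Re (f (node N j) * cnj (dirichlet d (node N j))))"
      by (rule sum_mono)
    also have "\<dots> = Re (\<Sum>j<N. apply_bcontfun (Q (shift (node N j) F)) (- node N j))"
      by (simp only: eq Re_sum)
    also have "\<dots> \<le> cmod (\<Sum>j<N. apply_bcontfun (Q (shift (node N j) F)) (- node N j))"
      by (rule complex_Re_le_cmod)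
    also have "\<dots> \<le> (\<Sum>j<N. B * (1 + e))"
      by (rule sum_norm_le) (rule order_trans[OF norm_bounded Q_le])
    also have "(\<Sum>j<N. (1 - e) * cmod (dirichlet d (node N j)) - e) =
        (1 - e) * (\<Sum>j<N. cmod (dirichlet d (node N j))) - N * e"
      by (simp only: sum_subtractf sum_distrib_left) simp
    also have "(\<Sum>j<N. cmod (dirichlet d (node N j))) = N * R" using N by (simp add: R_def)
    also have "(1 - e) * (N * R) - N * e = N * ((1 - e) * R - e)" by (simp add: algebra_simps)
    finally have "(1 - e) * R - e \<le> B * (1 + e)" using N by simp
    moreover have "(1 - e) * (lebesgue_const d - e) \<le> (1 - e) * R" using R e by (intro mult_left_mono) auto
    ultimately show ?thesis by linarith
  qed
  show ?thesis
  proof (rule tendsto_le)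
    show "((\<lambda>e. (1 - e) * (lebesgue_const d - e) - e) \<longlongrightarrow> lebesgue_const d) (at_right 0)"
      by (rule tendsto_eq_intros refl | simp)+
    show "((\<lambda>e. B * (1 + e)) \<longlongrightarrow> B) (at_right 0)"
      by (rule tendsto_eq_intros refl | simp)+
    have "\<forall>\<^sub>F e in at_right 0. e \<in> {0<..<1::real}" by (rule eventually_at_right_real) simp
    then show "\<forall>\<^sub>F e in at_right 0. (1 - e) * (lebesgue_const d - e) - e \<le> B * (1 + e)"
      by eventually_elim (use key in auto)
  qed simp
qed

section \<open>Copies of the function space in large universes\<close>

text \<open>A copy inside the universe \<open>'y\<close> of the space of bounded continuous functions.\<close>
definition transported :: "((real \<Rightarrow>\<^sub>C complex) \<Rightarrow> 'y) \<Rightarrow> 'y normed_module" where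
  "transported h =
     \<lparr>carrier = range h, monoid.mult = undefined, one = undefined, ring.zero = h 0,
      add = (\<lambda>x y. h (inv_into UNIV h x + inv_into UNIV h y)), smult = (\<lambda>a x. h (smul a (inv_into UNIV h x))),
      vnorm = (\<lambda>x. norm (inv_into UNIV h x))\<rparr>"

lemma transported_simps [simp]:
  assumes "inj h"
  shows "carrier (transported h) = range h" "\<zero>\<^bsub>transported h\<^esub> = h 0"
    "h f \<oplus>\<^bsub>transported h\<^esub> h g = h (f + g)" "a \<odot>\<^bsub>transported h\<^esub> h f = h (smul a f)"
    "\<parallel>h f\<parallel>\<^bsub>transported h\<^esub> = norm f"
  using assms by (simp_all add: transported_def)

lemma complex_banach_space_transported:
  assumes inj: "inj h"
  shows "complex_banach_space (transported h)"
proof -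
  let ?Y = "transported h"
  note [simp] = transported_simps[OF inj]
  have grp: "abelian_group ?Y"
  proof (rule abelian_groupI)
    fix x assume "x \<in> carrier ?Y"
    then obtain f where "x = h f" by auto
    then show "\<exists>y\<in>carrier ?Y. y \<oplus>\<^bsub>?Y\<^esub> x = \<zero>\<^bsub>?Y\<^esub>" by (intro bexI[of _ "h (- f)"]) auto
  qed (auto simp: add_ac)
  then interpret abelian_group ?Y .
  have "module complex_field ?Y"
    by (rule moduleI[OF cring_complex_field grp])
      (auto intro!: arg_cong[of _ _ h] bcontfun_eqI simp: algebra_simps)
  moreover have "complex_normed_space_axioms ?Y"
  proof
    show "\<parallel>x \<oplus>\<^bsub>?Y\<^esub> y\<parallel>\<^bsub>?Y\<^esub> \<le> \<parallel>x\<parallel>\<^bsub>?Y\<^esub> + \<parallel>y\<parallel>\<^bsub>?Y\<^esub>"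
      if "x \<in> carrier ?Y" "y \<in> carrier ?Y" for x y
      using that by (auto simp: norm_triangle_ineq)
  qed (auto simp: norm_smul)
  moreover have diff: "h f \<ominus>\<^bsub>?Y\<^esub> h g = h (f - g)" for f g
  proof -
    have "\<ominus>\<^bsub>?Y\<^esub> h g = h (- g)" by (rule minus_equality) simp_all
    then show ?thesis by (simp add: a_minus_def)
  qed
  have "complex_banach_space_axioms ?Y"
  proof
    fix f :: "nat \<Rightarrow> 'a"
    assume ran: "range f \<subseteq> carrier ?Y"
      and cauchy: "\<And>e. e > 0 \<Longrightarrow> \<exists>N. \<forall>m\<ge>N. \<forall>n\<ge>N. \<parallel>f m \<ominus>\<^bsub>?Y\<^esub> f n\<parallel>\<^bsub>?Y\<^esub> < e"
    define F where "F n = inv_into UNIV h (f n)" for n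
    have f: "f n = h (F n)" for n
      using ran by (auto simp: F_def f_inv_into_f image_subset_iff)
    have "Cauchy F"
      using cauchy by (intro CauchyI) (simp add: f diff)
    then obtain L where "F \<longlonglongrightarrow> L" using Cauchy_convergent_iff convergent_def by blast
    then have "(\<lambda>n. norm (F n - L)) \<longlonglongrightarrow> 0" by (simp add: tendsto_norm_zero_iff LIM_zero_iff)
    then show "\<exists>x\<in>carrier ?Y. (\<lambda>n. \<parallel>f n \<ominus>\<^bsub>?Y\<^esub> x\<parallel>\<^bsub>?Y\<^esub>) \<longlonglongrightarrow> 0"
      by (intro bexI[of _ "h L"]) (simp_all add: f diff)
  qed
  ultimately show ?thesis
    by (simp add: complex_banach_space_def complex_normed_space_def)
qed

text \<open>A continuous function is encoded by the Dedekind cuts of its values at rational points.\<close>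
lemma ex_inj_bcontfun_real: "\<exists>g :: (real \<Rightarrow>\<^sub>C complex) \<Rightarrow> real. inj g"
proof -
  define cuts :: "(real \<Rightarrow>\<^sub>C complex) \<Rightarrow> (rat \<times> bool \<times> rat) set" where
    "cuts f = {(q, b, r). of_rat r < (if b then Re (f (of_rat q)) else Im (f (of_rat q)))}" for f
  have "inj cuts"
  proof (rule injI)
    fix f g assume eq: "cuts f = cuts g"
    have real_eq: "x = y" if "\<And>r. (of_rat r < x) = (of_rat r < y)" for x y :: real
    proof (rule ccontr)
      assume "x \<noteq> y"
      then consider "x < y" | "y < x" by linarith
      then show False
        using of_rat_dense[of x y] of_rat_dense[of y x] that by cases (auto dest: less_asym)
    qed
    have mem: "(q, b, r) \<in> cuts f \<longleftrightarrow> (q, b, r) \<in> cuts g" for q b r using eq by simp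
    have "f (of_rat q) = g (of_rat q)" for q
    proof (rule complex_eqI; rule real_eq)
      show "(of_rat r < Re (f (of_rat q))) = (of_rat r < Re (g (of_rat q)))" for r
        using mem[of q True r] by (simp add: cuts_def)
      show "(of_rat r < Im (f (of_rat q))) = (of_rat r < Im (g (of_rat q)))" for r
        using mem[of q False r] by (simp add: cuts_def)
    qed
    then have "\<rat> \<subseteq> {x. f x = g x}" by (auto simp: Rats_def)
    moreover have "closed {x. f x = g x}" by (intro closed_Collect_eq continuous_on_apply_bcontfun)
    ultimately have "closure \<rat> \<subseteq> {x. f x = g x}" by (rule closure_minimal)
    then show "f = g" by (intro bcontfun_eqI) (auto simp: Rats_closure_real)
  qed
  \<comment> \<open>The triples are countable, so their sets are coded by sets of natural numbers,
    which are equinumerous with the reals.\<close>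
  moreover have "inj (\<lambda>S :: (rat \<times> bool \<times> rat) set. to_nat ` S)"
    by (rule injI) (simp add: inj_image_eq_iff)
  moreover obtain e :: "nat set \<Rightarrow> real" where "inj e"
    using nat_sets_eqpoll_reals by (auto simp: eqpoll_def bij_betw_def)
  ultimately have "inj (e \<circ> (\<lambda>S. to_nat ` S) \<circ> cuts)" by (intro inj_compose)
  then show ?thesis by blast
qed

text \<open>Since the constant is a supremum, one superspace is enough: the transported copy of the
  bounded continuous functions, with \<open>lift\<close> as the embedding. A projection there is
  pulled back along \<open>h\<close> to an operator \<open>Q\<close>, to which the averaging
  argument applies.\<close>

lemma le_proj_const:
  fixes emb :: "real \<Rightarrow> 'y"
  assumes "inj emb"
  shows "ereal (lebesgue_const d) \<le> proj_const TYPE('y) (circle_polys d)"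
proof -
  obtain g :: "(real \<Rightarrow>\<^sub>C complex) \<Rightarrow> real" where "inj g" using ex_inj_bcontfun_real by blast
  define h where "h = emb \<circ> g"
  have inj: "inj h" unfolding h_def by (rule inj_compose[OF assms \<open>inj g\<close>])
  note [simp] = transported_simps[OF inj]
  let ?X = "circle_polys d" and ?Y = "transported h"
  define J where "J p = Bcontfun (lift d p)" for p
  define I where "I p = h (J p)" for p
  have J: "apply_bcontfun (J p) = lift d p" if p: "p \<in> carrier ?X" for p
  proof -
    obtain a where "lift d p = trig_sum d a" using lift_circle_poly[OF p] by blast
    then have "continuous_on UNIV (lift d p)"
      by (simp add: trig_sum_def[abs_def]) (intro continuous_intros)
    then have "lift d p \<in> bcontfun" by (rule bcontfun_normI) (rule norm_lift_le[OF p])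
    then show ?thesis by (simp add: J_def Bcontfun_inverse)
  qed
  have J_norm: "norm (J p) = \<parallel>p\<parallel>\<^bsub>?X\<^esub>" if "p \<in> carrier ?X" for p
  proof (rule antisym)
    show "norm (J p) \<le> \<parallel>p\<parallel>\<^bsub>?X\<^esub>" by (rule norm_bound) (simp add: J that norm_lift_le)
    show "\<parallel>p\<parallel>\<^bsub>?X\<^esub> \<le> norm (J p)"
      by (rule vnorm_circle_polys_le) (use norm_bounded[of "J p"] J[OF that] in simp)
  qed
  have "I \<in> linear_maps ?X ?Y"
    unfolding linear_maps_def I_def
    by (auto simp: J lift_add lift_smult circle_polys_add_closed circle_polys_smult_closed
        intro!: arg_cong[of _ _ h] bcontfun_eqI)
  then have I: "I \<in> isometric_embeddings ?X ?Y"
    by (simp add: isometric_embeddings_def I_def J_norm)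
  have "ereal (lebesgue_const d) \<le> rel_proj_const (I ` carrier ?X) ?Y"
    unfolding rel_proj_const_def
  proof (rule Inf_greatest, clarify)
    fix P
    let ?YM = "?Y\<lparr>carrier := I ` carrier ?X\<rparr>"
    assume P: "P \<in> bounded_linear_maps ?Y ?YM" and P_id: "\<forall>x\<in>I ` carrier ?X. P x = x"
    define Q where "Q f = inv_into UNIV h (P (h f))" for f
    have P_M: "P (h f) \<in> I ` carrier ?X" for f
      using P by (auto simp: bounded_linear_maps_def linear_maps_def)
    have hQ: "h (Q f) = P (h f)" for f
      using P_M[of f] by (auto simp: Q_def I_def inj)
    have Q_add: "Q (f + g) = Q f + Q g" for f g
    proof -
      have "P (h f \<oplus>\<^bsub>?Y\<^esub> h g) = P (h f) \<oplus>\<^bsub>?Y\<^esub> P (h g)"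
        using P by (simp add: bounded_linear_maps_def linear_maps_def)
      then have "h (Q (f + g)) = h (Q f + Q g)" by (simp add: hQ[symmetric])
      then show ?thesis using inj by (simp add: inj_eq)
    qed
    have Q_smul: "Q (smul a f) = smul a (Q f)" for a f
    proof -
      have "P (a \<odot>\<^bsub>?Y\<^esub> h f) = a \<odot>\<^bsub>?Y\<^esub> P (h f)"
        using P by (simp add: bounded_linear_maps_def linear_maps_def)
      then have "h (Q (smul a f)) = h (smul a (Q f))" by (simp add: hQ[symmetric])
      then show ?thesis using inj by (simp add: inj_eq)
    qed
    have Q_range: "\<exists>a. apply_bcontfun (Q f) = trig_sum d a" for f
    proof -
      obtain p where p: "p \<in> carrier ?X" "P (h f) = I p" using P_M[of f] by blast
      then have "Q f = J p" using inj by (simp add: Q_def I_def)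
      then show ?thesis using J[OF p(1)] lift_circle_poly[OF p(1)] by simp
    qed
    have Q_char: "Q (character (int k)) = character (int k)" if k: "k \<le> d" for k
    proof -
      obtain p where p: "p \<in> carrier ?X" "lift d p = trig_sum d (\<lambda>l. if l = k then 1 else 0)"
        using ex_circle_poly by blast
      \<comment> \<open>The characters of frequencies 0 to \<open>d\<close> are lifts of circle
        polynomials, hence lie in the image of the embedding and are fixed by the
        projection.\<close>
      have "J p = character (int k)"
        by (rule bcontfun_eqI) (simp add: J p trig_sum_def if_distrib[of "\<lambda>x. x * _"] k cong: if_cong)
      then show ?thesis using P_id p(1) inj by (auto simp: Q_def I_def)
    qed
    have ge: "ereal (norm (Q f)) \<le> op_norm ?Y ?YM P" if "norm f \<le> 1" for f
    proof -
      have "ereal (\<parallel>P (h f)\<parallel>\<^bsub>?YM\<^esub>) \<le> op_norm ?Y ?YM P"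
        unfolding op_norm_def by (rule SUP_upper) (use that in simp)
      then show ?thesis by (simp add: hQ[symmetric])
    qed
    show "ereal (lebesgue_const d) \<le> op_norm ?Y ?YM P"
    \<comment> \<open>An infinite operator norm satisfies the inequality trivially, and the value at
      0 excludes minus infinity; only the real case has content.\<close>
    proof (cases "op_norm ?Y ?YM P")
      case (real B)
      have "lebesgue_const d \<le> B"
        by (rule lebesgue_const_le_norm_projection[of Q]) (use ge real Q_add Q_smul Q_range Q_char in auto)
      then show ?thesis using real by simp
    next
      case MInf
      then show ?thesis using ge[of 0] by simp
    qed simp
  qed
  also have "\<dots> \<le> proj_const TYPE('y) ?X"
    unfolding proj_const_def
    by (rule Sup_upper) (use I complex_banach_space_transported[OF inj] in blast)
  finally show ?thesis .
qed

lemma proj_const_le: "proj_const TYPE('y) (circle_polys d) \<le> ereal (lebesgue_const d)"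
  unfolding proj_const_def
  by (rule Sup_least) (auto intro!: rel_proj_const_le simp: complex_banach_space_def)

theorem proposition4p5:
  fixes emb :: "real \<Rightarrow> 'y"
  assumes large_universe: "inj emb"
  shows "(\<forall>d \<ge> 1. proj_const TYPE('y) (circle_polys d) =
            ereal (1 / (2 * pi) *
              integral {0..2 * pi} (\<lambda>t. \<bar>sin ((real d + 1) / 2 * t) / sin (t / 2)\<bar>))) \<and>
         (\<lambda>d. proj_const TYPE('y) (circle_polys d) / ereal (ln (real d)))
            \<longlonglongrightarrow> ereal (4 / pi\<^sup>2)"
proof -
  have eq: "proj_const TYPE('y) (circle_polys d) = ereal (lebesgue_const d)" for d
    using proj_const_le le_proj_const[OF large_universe] by (rule antisym)
  \<comment> \<open>At \<open>d = 1\<close> the logarithm is 0, and division by zero differs between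
    the reals and \<open>ereal\<close>; hence equality only eventually.\<close>
  have "\<forall>\<^sub>F d in sequentially. ereal (lebesgue_const d / ln (real d)) = ereal (lebesgue_const d) / ereal (ln (real d))"
    using eventually_gt_at_top[of 1] by eventually_elim simp
  moreover have "(\<lambda>d. ereal (lebesgue_const d / ln (real d))) \<longlonglongrightarrow> ereal (4 / pi\<^sup>2)"
    using lebesgue_const_asymptotics by simp
  ultimately have "(\<lambda>d. ereal (lebesgue_const d) / ereal (ln (real d))) \<longlonglongrightarrow> ereal (4 / pi\<^sup>2)"
    by (rule Lim_transform_eventually[rotated])
  then show ?thesis by (simp add: eq lebesgue_const_altdef)
qed

end
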